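(* Let $d\ge 1$, $\sigma_d>0$, and $x,y\in\mathbb{R}^d$ with $x\neq y$. Let $(x',y')$ be the random pair in $\mathbb{R}^d\times\mathbb{R}^d$ output by the sampling procedure $\mathsf{MaxOT}_d(x,y,\sigma_d)$ described in the context. Then $(x',y')$ follows a maximal optimal transport coupling of $\mathrm{N}(x,I_d\sigma_d^2)$ and $\mathrm{N}(y,I_d\sigma_d^2)$.
   Context: Couplings. For probability measures $\mu,\nu$ on $\mathbb{R}^d$ (Borel $\sigma$-algebra $\mathcal{B}$), a coupling of $\mu$ and $\nu$ is a probability measure on $\mathbb{R}^d\times\mathbb{R}^d$ with marginals $\mu$ and $\nu$. It is maximal if $(x',y')$ drawn from it satisfies $\mathbb{P}(x'=y')=1-\sup_{A\in\mathcal{B}}|\mu(A)-\nu(A)|$. The residuals of a maximal coupling of $\mu\ne\nu$ are the conditional laws of $x'$ and of $y'$ given $x'\neq y'$. A coupling of two laws on $\mathbb{R}^d$ is an optimal transport coupling if it minimizes $\mathbb{E}[\lVert y'-x'\rVert^2]$ among all couplings of these two laws. A maximal optimal transport coupling of $\mu$ and $\nu$ is a maximal coupling of $\mu$ and $\nu$ such that the conditional law of $(x',y')$ given $x'\neq y'$ is an optimal transport coupling of the two residuals. Notation. $\mathrm{N}(\mu,\Sigma)$ is the multivariate normal law and $\mathrm{N}(z;\mu,\Sigma)$ its density at $z$; $\mathrm{Unif}$ is the uniform distribution on $[0,1]$; $^{\top}$ denotes transpose. One-dimensional transport map. For reals $u\neq v$ and $\sigma>0$, let $\Phi_u$ and $\Phi_v$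 be the cumulative distribution functions of the laws on $\mathbb{R}$ with densities proportional to $\max(0,\mathrm{N}(z;u,\sigma^2)-\mathrm{N}(z;v,\sigma^2))$ and $\max(0,\mathrm{N}(z;v,\sigma^2)-\mathrm{N}(z;u,\sigma^2))$ respectively (these are the residual laws of any maximal coupling of $\mathrm{N}(u,\sigma^2)$ and $\mathrm{N}(v,\sigma^2)$). Define $t_{uv}(w)=\Phi_v^{-1}(\Phi_u(w))$, where $\Phi_v^{-1}$ is the inverse of $\Phi_v$ on $(0,1)$ (quantile function). One-dimensional procedure, for reals $u\neq v$, $\sigma>0$: 1. Draw $u'\sim\mathrm{N}(u,\sigma^2)$ and, independently, $W\sim\mathrm{Unif}$. 2. If $W\,\mathrm{N}(u';u,\sigma^2)\le\mathrm{N}(u';v,\sigma^2)$, set $v'=u'$. 3. Otherwise set $v'=t_{uv}(u')$. 4. Return $(u',v')$. Procedure $\mathsf{MaxOT}_d(x,y,\sigma_d)$ (draws in different steps are independent): 1. Compute $e=(y-x)/\lVert y-x\rVert$, $m=(y+x)/2$, $x_1=e^{\top}x$, $y_1=e^{\top}y$. 2. Draw $(x_1',y_1')$ by running the one-dimensional procedure with $u=x_1$, $v=y_1$, $\sigma=\sigma_d$. 3. Draw $\tilde z\sim\mathrm{N}(m,I_d\sigma_d^2)$, set $z'_{-1}=(I_d-ee^{\top})\tilde z$, $x'=x_1'e+z'_{-1}$, and $y'=y_1'e+z'_{-1}$. 4. Return $(x',y')$. *)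

theory Defs
  imports "HOL-Probability.Probability"
begin

definition is_coupling ::
    "'a::euclidean_space measure \<Rightarrow> 'a measure \<Rightarrow> ('a \<times> 'a) measure \<Rightarrow> bool" where
  "is_coupling \<mu> \<nu> \<gamma> \<longleftrightarrow>
     prob_space \<gamma> \<and> sets \<gamma> = sets borel \<and>
     distr \<gamma> borel fst = \<mu> \<and> distr \<gamma> borel snd = \<nu>"

definition is_maximal_coupling ::
    "'a::euclidean_space measure \<Rightarrow> 'a measure \<Rightarrow> ('a \<times> 'a) measure \<Rightarrow> bool" where
  "is_maximal_coupling \<mu> \<nu> \<gamma> \<longleftrightarrow>
     is_coupling \<mu> \<nu> \<gamma> \<and>
     measure \<gamma> {p. fst p = snd p} = 1 - (SUP A\<in>sets borel. \<bar>measure \<mu> A - measure \<nu> A\<bar>)"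

text \<open>The cost is an \<^typ>\<open>ennreal\<close>-valued integral, so that couplings of infinite cost are compared
  correctly.\<close>

definition is_ot_coupling ::
    "'a::euclidean_space measure \<Rightarrow> 'a measure \<Rightarrow> ('a \<times> 'a) measure \<Rightarrow> bool" where
  "is_ot_coupling \<mu> \<nu> \<gamma> \<longleftrightarrow>
     is_coupling \<mu> \<nu> \<gamma> \<and>
     (\<forall>\<gamma>'. is_coupling \<mu> \<nu> \<gamma>' \<longrightarrow>
        (\<integral>\<^sup>+ p. ennreal ((norm (snd p - fst p))\<^sup>2) \<partial>\<gamma>)
          \<le> (\<integral>\<^sup>+ p. ennreal ((norm (snd p - fst p))\<^sup>2) \<partial>\<gamma>'))"

text \<open>Conditioning a law on an event is \<^const>\<open>uniform_measure\<close>.\<close>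

definition off_diagonal_law :: "('a::euclidean_space \<times> 'a) measure \<Rightarrow> ('a \<times> 'a) measure" where
  "off_diagonal_law \<gamma> = uniform_measure \<gamma> {p. fst p \<noteq> snd p}"

definition residual_fst :: "('a::euclidean_space \<times> 'a) measure \<Rightarrow> 'a measure" where
  "residual_fst \<gamma> = distr (off_diagonal_law \<gamma>) borel fst"

definition residual_snd :: "('a::euclidean_space \<times> 'a) measure \<Rightarrow> 'a measure" where
  "residual_snd \<gamma> = distr (off_diagonal_law \<gamma>) borel snd"

text \<open>Intended for \<open>\<mu> \<noteq> \<nu>\<close>. A maximal coupling of \<open>\<mu> = \<nu>\<close> puts no mass off the diagonal; there the
  conditional law is not a probability measure and the predicate is false.\<close>

definition is_maximal_ot_coupling ::
    "'a::euclidean_space measure \<Rightarrow> 'a measure \<Rightarrow> ('a \<times> 'a) measure \<Rightarrow> bool" where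
  "is_maximal_ot_coupling \<mu> \<nu> \<gamma> \<longleftrightarrow>
     is_maximal_coupling \<mu> \<nu> \<gamma> \<and>
     is_ot_coupling (residual_fst \<gamma>) (residual_snd \<gamma>) (off_diagonal_law \<gamma>)"

text \<open>Meaningful for symmetric positive definite \<open>\<Sigma>\<close>.\<close>

definition mvn_density :: "real^'n \<Rightarrow> real^'n^'n \<Rightarrow> real^'n \<Rightarrow> real" where
  "mvn_density \<mu> \<Sigma> z =
     exp (- ((z - \<mu>) \<bullet> (matrix_inv \<Sigma> *v (z - \<mu>))) / 2) / sqrt ((2 * pi) ^ CARD('n) * det \<Sigma>)"

definition mvn :: "real^'n \<Rightarrow> real^'n^'n \<Rightarrow> (real^'n) measure" where
  "mvn \<mu> \<Sigma> = density lborel (\<lambda>z. ennreal (mvn_density \<mu> \<Sigma> z))"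

text \<open>In dimension one, \<^const>\<open>normal_density\<close> takes the standard deviation \<open>\<sigma>\<close>, not the variance.\<close>

definition normal_law :: "real \<Rightarrow> real \<Rightarrow> real measure" where
  "normal_law u \<sigma> = density lborel (\<lambda>z. ennreal (normal_density u \<sigma> z))"

definition unif :: "real measure" where
  "unif = uniform_measure lborel {0..1}"

definition law_proportional_to :: "(real \<Rightarrow> real) \<Rightarrow> real measure" where
  "law_proportional_to f = density lborel (\<lambda>z. ennreal (f z / (LINT s|lborel. f s)))"

definition residual_cdf :: "real \<Rightarrow> real \<Rightarrow> real \<Rightarrow> real \<Rightarrow> real" where
  "residual_cdf u v \<sigma> =
     cdf (law_proportional_to (\<lambda>z. max 0 (normal_density u \<sigma> z - normal_density v \<sigma> z)))"

definition quantile :: "(real \<Rightarrow> real) \<Rightarrow> real \<Rightarrow> real" where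
  "quantile F p = Inf {z. p \<le> F z}"

text \<open>\<open>\<Phi>\<^sub>u\<close> is \<open>residual_cdf u v \<sigma>\<close> and \<open>\<Phi>\<^sub>v\<close> is \<open>residual_cdf v u \<sigma>\<close>. The value is only meaningful
  where \<open>\<Phi>\<^sub>u w\<close> lies strictly between 0 and 1, which holds wherever \<open>u\<close> has the larger density.\<close>

definition transport_map :: "real \<Rightarrow> real \<Rightarrow> real \<Rightarrow> real \<Rightarrow> real" where
  "transport_map u v \<sigma> w = quantile (residual_cdf v u \<sigma>) (residual_cdf u v \<sigma> w)"

text \<open>The sampling procedures are represented by the law of their output: the image, under the
  deterministic steps, of the product measure of the independent draws.\<close>

definition MaxOT1 :: "real \<Rightarrow> real \<Rightarrow> real \<Rightarrow> (real \<times> real) measure" where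
  "MaxOT1 u v \<sigma> =
     distr (normal_law u \<sigma> \<Otimes>\<^sub>M unif) borel
       (\<lambda>(u', W).
          (u', if W * normal_density u \<sigma> u' \<le> normal_density v \<sigma> u' then u'
               else transport_map u v \<sigma> u'))"

definition MaxOT :: "real^'n \<Rightarrow> real^'n \<Rightarrow> real \<Rightarrow> ((real^'n) \<times> (real^'n)) measure" where
  "MaxOT x y \<sigma> =
     (let e = (y - x) /\<^sub>R norm (y - x);
          m = (y + x) /\<^sub>R 2;
          P = mat 1 - (\<chi> i j. e $ i * e $ j)
      in distr (MaxOT1 (e \<bullet> x) (e \<bullet> y) \<sigma> \<Otimes>\<^sub>M mvn m (\<sigma>\<^sup>2 *\<^sub>R mat 1)) borel
           (\<lambda>((x1', y1'), z). (x1' *\<^sub>R e + P *v z, y1' *\<^sub>R e + P *v z)))"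

end

theory Submission
  imports Defs
begin

text \<open>
  Write \<open>p\<close>, \<open>q\<close> for the two Gaussian densities and \<open>e\<close> for the unit vector from \<open>x\<close> to \<open>y\<close>. Both densities
  have the same factor transverse to \<open>e\<close>, so the output law is \<open>min p q\<close> carried by the diagonal plus
  \<open>max 0 (p - q)\<close> carried by the graph of \<open>T w = w + (t (e \<bullet> w) - e \<bullet> w) e\<close>, where \<open>t\<close> is the one-dimensional
  transport map. Since \<open>T\<close> pushes \<open>max 0 (p - q)\<close> to \<open>max 0 (q - p)\<close>, the coupling is maximal.

  For optimality only the \<open>e\<close>-coordinates \<open>X\<close>, \<open>Y\<close> matter. The first residual lives on \<open>X < c\<close> and the second on
  \<open>Y > c\<close>, where \<open>c\<close> is the midpoint, so that
  \<open>(Y - X)\<^sup>2 = (c - X)\<^sup>2 + (Y - c)\<^sup>2 + 2 (c - X) (Y - c)\<close> with all terms nonnegative. By a layer-cake formula the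
  last term integrates to an integral of probabilities of intersections, each of which is the smallest that the
  marginals allow because \<open>t\<close> is increasing. No moments are needed.
\<close>

section \<open>Optimality of monotone couplings\<close>

text \<open>Couplings carry the Borel sigma-algebra of the product type, so the projections are
  needed as Borel maps there, and not only on the product of two Borel sigma-algebras.\<close>

lemma borel_measurable_fst_snd [measurable]:
  "fst \<in> borel_measurable (borel :: ('a::topological_space \<times> 'b::topological_space) measure)"
  "snd \<in> borel_measurable (borel :: ('a \<times> 'b) measure)"
  by (intro borel_measurable_continuous_onI continuous_on_fst continuous_on_snd continuous_on_id)+

text \<open>The product of the positive parts of \<open>f x\<close> and \<open>g x\<close> is the
  area of a rectangle of points \<open>(a, b)\<close>. Tonelli moves the integral over
  \<open>x\<close> innermost, where it measures a joint upper level set.\<close>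

lemma (in sigma_finite_measure) nn_integral_mult_layer_cake:
  fixes f g :: "'a \<Rightarrow> real"
  assumes [measurable]: "f \<in> borel_measurable M" "g \<in> borel_measurable M"
  shows "(\<integral>\<^sup>+x. ennreal (f x) * ennreal (g x) \<partial>M) =
    (\<integral>\<^sup>+a. \<integral>\<^sup>+b. indicator {0..} a * indicator {0..} b * emeasure M {x \<in> space M. a < f x \<and> b < g x} \<partial>lborel \<partial>lborel)"
proof -
  interpret L: pair_sigma_finite M "lborel :: real measure" ..
  \<comment> \<open>For negative \<open>r\<close> both sides vanish: \<open>ennreal\<close>
    truncates and the interval is empty. Hence no sign condition on \<open>f\<close> and
    \<open>g\<close>.\<close>
  have layer: "ennreal r = (\<integral>\<^sup>+a. indicator {0..<r} a \<partial>lborel)" for r :: real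
    by (cases "0 \<le> r") (auto simp: ennreal_neg)
  have "(\<integral>\<^sup>+x. ennreal (f x) * ennreal (g x) \<partial>M) =
      (\<integral>\<^sup>+x. \<integral>\<^sup>+a. \<integral>\<^sup>+b. indicator {0..<f x} a * indicator {0..<g x} b \<partial>lborel \<partial>lborel \<partial>M)"
    by (simp add: layer nn_integral_cmult nn_integral_multc del: nn_integral_indicator emeasure_lborel_Ico)
  also have "\<dots> = (\<integral>\<^sup>+x. \<integral>\<^sup>+a. \<integral>\<^sup>+b. of_bool (0 \<le> a \<and> a < f x \<and> 0 \<le> b \<and> b < g x) \<partial>lborel \<partial>lborel \<partial>M)"
    by (intro nn_integral_cong) (auto split: split_indicator)
  also have "\<dots> = (\<integral>\<^sup>+a. \<integral>\<^sup>+x. \<integral>\<^sup>+b. of_bool (0 \<le> a \<and> a < f x \<and> 0 \<le> b \<and> b < g x) \<partial>lborel \<partial>M \<partial>lborel)"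
    by (intro L.Fubini'[symmetric]) measurable
  also have "\<dots> = (\<integral>\<^sup>+a. \<integral>\<^sup>+b. \<integral>\<^sup>+x. of_bool (0 \<le> a \<and> a < f x \<and> 0 \<le> b \<and> b < g x) \<partial>M \<partial>lborel \<partial>lborel)"
    by (intro nn_integral_cong L.Fubini'[symmetric]) measurable
  also have "\<dots> = (\<integral>\<^sup>+a. \<integral>\<^sup>+b. \<integral>\<^sup>+x. indicator {0..} a * indicator {0..} b * indicator {x \<in> space M. a < f x \<and> b < g x} x \<partial>M \<partial>lborel \<partial>lborel)"
    by (intro nn_integral_cong) (auto split: split_indicator)
  also have "\<dots> = (\<integral>\<^sup>+a. \<integral>\<^sup>+b. indicator {0..} a * indicator {0..} b * emeasure M {x \<in> space M. a < f x \<and> b < g x} \<partial>lborel \<partial>lborel)"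
    by (intro nn_integral_cong) (simp add: nn_integral_cmult)
  finally show ?thesis .
qed

lemma nn_integral_coupling_fst:
  assumes "is_coupling \<mu> \<nu> \<gamma>" "h \<in> borel_measurable borel"
  shows "(\<integral>\<^sup>+p. h (fst p) \<partial>\<gamma>) = (\<integral>\<^sup>+w. h w \<partial>\<mu>)"
proof -
  have "sets \<gamma> = sets borel" and \<mu>: "\<mu> = distr \<gamma> borel fst"
    using assms by (auto simp: is_coupling_def)
  note [measurable_cong] = this(1)
  show ?thesis unfolding \<mu> using assms(2) by (subst nn_integral_distr) auto
qed

lemma nn_integral_coupling_snd:
  assumes "is_coupling \<mu> \<nu> \<gamma>" "h \<in> borel_measurable borel"
  shows "(\<integral>\<^sup>+p. h (snd p) \<partial>\<gamma>) = (\<integral>\<^sup>+w. h w \<partial>\<nu>)"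
proof -
  have "sets \<gamma> = sets borel" and \<nu>: "\<nu> = distr \<gamma> borel snd"
    using assms by (auto simp: is_coupling_def)
  note [measurable_cong] = this(1)
  show ?thesis unfolding \<nu> using assms(2) by (subst nn_integral_distr) auto
qed

text \<open>An almost sure property of one coordinate depends on that marginal alone, so it passes
  from one coupling to any other with the same marginals.\<close>

lemma AE_coupling_fst:
  assumes "is_coupling \<mu> \<nu> \<gamma>" "{w. P w} \<in> sets borel"
  shows "(AE p in \<gamma>. P (fst p)) \<longleftrightarrow> (AE w in \<mu>. P w)"
proof -
  have s: "sets \<gamma> = sets borel" and \<mu>: "\<mu> = distr \<gamma> borel fst"
    using assms by (auto simp: is_coupling_def)
  have "fst \<in> measurable \<gamma> borel" unfolding measurable_cong_sets[OF s refl] by measurable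
  then show ?thesis unfolding \<mu> using assms(2) by (subst AE_distr_iff) auto
qed

lemma AE_coupling_snd:
  assumes "is_coupling \<mu> \<nu> \<gamma>" "{w. P w} \<in> sets borel"
  shows "(AE p in \<gamma>. P (snd p)) \<longleftrightarrow> (AE w in \<nu>. P w)"
proof -
  have s: "sets \<gamma> = sets borel" and \<nu>: "\<nu> = distr \<gamma> borel snd"
    using assms by (auto simp: is_coupling_def)
  have "snd \<in> measurable \<gamma> borel" unfolding measurable_cong_sets[OF s refl] by measurable
  then show ?thesis unfolding \<nu> using assms(2) by (subst AE_distr_iff) auto
qed

text \<open>By the layer-cake formula it suffices to compare probabilities of
  \<open>A \<inter> B\<close> for upper level sets \<open>A\<close> of \<alpha> and \<open>B\<close>
  of \<beta>. Every coupling gives at least \<open>max 0 (P A + P B - 1)\<close>, where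
  \<open>P A\<close> and \<open>P B\<close> are fixed by the marginals, and an antitone support
  attains this bound.\<close>

lemma antitone_coupling_minimises_product:
  fixes \<alpha> \<beta> :: "'a::euclidean_space \<Rightarrow> real"
  assumes L: "is_coupling \<mu> \<nu> L" and G: "is_coupling \<mu> \<nu> G"
    and [measurable]: "\<alpha> \<in> borel_measurable borel" "\<beta> \<in> borel_measurable borel"
    and S: "AE p in L. p \<in> S"
    and anti: "\<And>p q. p \<in> S \<Longrightarrow> q \<in> S \<Longrightarrow> \<alpha> (fst p) < \<alpha> (fst q) \<Longrightarrow> \<beta> (snd q) \<le> \<beta> (snd p)"
  shows "(\<integral>\<^sup>+p. ennreal (\<alpha> (fst p)) * ennreal (\<beta> (snd p)) \<partial>L)
       \<le> (\<integral>\<^sup>+p. ennreal (\<alpha> (fst p)) * ennreal (\<beta> (snd p)) \<partial>G)"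
proof -
  have sL: "sets L = sets borel" and sG: "sets G = sets borel"
    using L G by (auto simp: is_coupling_def)
  interpret L: prob_space L using L by (simp add: is_coupling_def)
  interpret G: prob_space G using G by (simp add: is_coupling_def)
  note [measurable_cong] = sL sG
  have sp: "space L = UNIV" "space G = UNIV"
    using sL sG by (auto dest: sets_eq_imp_space_eq)
  have "emeasure L {p \<in> space L. a < \<alpha> (fst p) \<and> b < \<beta> (snd p)}
      \<le> emeasure G {p \<in> space G. a < \<alpha> (fst p) \<and> b < \<beta> (snd p)}" for a b
  proof -
    define A B :: "('a \<times> 'a) set" where "A = {p. a < \<alpha> (fst p)}" and "B = {p. b < \<beta> (snd p)}"
    have [measurable]: "A \<in> sets L" "B \<in> sets L" "A \<in> sets G" "B \<in> sets G"
      unfolding A_def B_def by measurable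
    have e: "emeasure L A = emeasure G A" "emeasure L B = emeasure G B"
    proof -
      have 1: "distr L borel fst = distr G borel fst" "distr L borel snd = distr G borel snd"
        using L G by (auto simp: is_coupling_def)
      from arg_cong[where f = "\<lambda>M. emeasure M {w. a < \<alpha> w}", OF 1(1)]
      show "emeasure L A = emeasure G A" by (simp add: emeasure_distr A_def vimage_def sp)
      from arg_cong[where f = "\<lambda>M. emeasure M {w. b < \<beta> w}", OF 1(2)]
      show "emeasure L B = emeasure G B" by (simp add: emeasure_distr B_def vimage_def sp)
    qed
    have eq: "{p \<in> space L. a < \<alpha> (fst p) \<and> b < \<beta> (snd p)} = A \<inter> B"
      "{p \<in> space G. a < \<alpha> (fst p) \<and> b < \<beta> (snd p)} = A \<inter> B"
      by (auto simp: sp A_def B_def)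
    \<comment> \<open>Either \<open>S\<close> misses \<open>A \<inter> B\<close>, and the left side
      is 0, or \<open>A \<union> B\<close> covers \<open>S\<close>, and inclusion-exclusion gives
      \<open>P A + P B - 1\<close>.\<close>
    have "L.prob (A \<inter> B) \<le> G.prob (A \<inter> B)"
    proof (cases "\<exists>p\<in>S. p \<in> A \<and> p \<in> B")
      case False
      then have "AE p in L. p \<notin> A \<inter> B" using S by auto
      then have "L.prob (A \<inter> B) = 0"
        by (subst L.prob_eq_0) auto
      then show ?thesis by simp
    next
      case True
      then obtain p where p: "p \<in> S" "p \<in> A" "p \<in> B" by auto
      \<comment> \<open>If \<open>q\<close> is not in \<open>A\<close>, then
        \<open>\<alpha> (fst q) \<le> a < \<alpha> (fst p)\<close>, so antitonicity gives
        \<open>b < \<beta> (snd p) \<le> \<beta> (snd q)\<close>.\<close>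
      have cover: "q \<in> A \<union> B" if "q \<in> S" for q
        using anti[of q p] p that by (force simp: A_def B_def)
      have "AE q in L. q \<in> A \<union> B" using S by eventually_elim (rule cover)
      then have "L.prob (A \<union> B) = 1" by (subst L.prob_eq_1) auto
      moreover have "L.prob (A \<union> B) = L.prob A + L.prob B - L.prob (A \<inter> B)"
        by (intro measure_Un3) (auto simp: L.fmeasurable_eq_sets)
      moreover have "G.prob (A \<union> B) = G.prob A + G.prob B - G.prob (A \<inter> B)"
        by (intro measure_Un3) (auto simp: G.fmeasurable_eq_sets)
      moreover have "L.prob A = G.prob A" "L.prob B = G.prob B"
        using e by (auto simp: measure_def)
      ultimately show ?thesis using G.prob_le_1[of "A \<union> B"] by simp
    qed
    then show ?thesis
      unfolding eq by (simp add: L.emeasure_eq_measure G.emeasure_eq_measure)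
  qed
  then show ?thesis
    by (subst L.nn_integral_mult_layer_cake, measurable)
      (subst G.nn_integral_mult_layer_cake, measurable, intro nn_integral_mono mult_left_mono, auto)
qed

text \<open>Splitting the displacement at the separating point \<open>c\<close>, the cross term is the only part of the cost that
  is not determined by the marginals.\<close>

lemma monotone_coupling_is_ot:
  fixes e :: "'a::euclidean_space"
  assumes L: "is_coupling \<mu> \<nu> L" and e: "norm e = 1"
    and S: "AE p in L. p \<in> S"
    and dir: "\<And>p. p \<in> S \<Longrightarrow> \<exists>r. snd p - fst p = r *\<^sub>R e"
    and sep: "\<And>p. p \<in> S \<Longrightarrow> e \<bullet> fst p \<le> c \<and> c \<le> e \<bullet> snd p"
    and mono: "\<And>p q. p \<in> S \<Longrightarrow> q \<in> S \<Longrightarrow> e \<bullet> fst p < e \<bullet> fst q \<Longrightarrow> e \<bullet> snd p \<le> e \<bullet> snd q"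
  shows "is_ot_coupling \<mu> \<nu> L"
  unfolding is_ot_coupling_def
proof (intro conjI allI impI L)
  fix G assume G: "is_coupling \<mu> \<nu> G"
  have s: "sets L = sets borel" "sets G = sets borel"
    using L G by (auto simp: is_coupling_def)
  note [measurable_cong] = s
  define a b where "a w = c - e \<bullet> w" and "b w = e \<bullet> w - c" for w
  have [measurable]: "a \<in> borel_measurable borel" "b \<in> borel_measurable borel"
    unfolding a_def b_def by measurable
  define cost where "cost p = ennreal ((a (fst p))\<^sup>2) + ennreal ((b (snd p))\<^sup>2)
      + 2 * (ennreal (a (fst p)) * ennreal (b (snd p)))" for p
  \<comment> \<open>The signs matter: \<open>ennreal\<close> would truncate a negative factor of the
    cross term to 0.\<close>
  have cost_eq: "ennreal ((e \<bullet> (snd p - fst p))\<^sup>2) = cost p" if "0 \<le> a (fst p)" "0 \<le> b (snd p)" for p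
  proof -
    have "(e \<bullet> (snd p - fst p))\<^sup>2 = (a (fst p))\<^sup>2 + (b (snd p))\<^sup>2 + 2 * (a (fst p) * b (snd p))"
      by (simp add: a_def b_def inner_diff_right power2_eq_square algebra_simps)
    then show ?thesis using that unfolding cost_def
      by (simp add: ennreal_plus ennreal_mult)
  qed
  have int: "(\<integral>\<^sup>+p. cost p \<partial>M) = (\<integral>\<^sup>+w. ennreal ((a w)\<^sup>2) \<partial>\<mu>) + (\<integral>\<^sup>+w. ennreal ((b w)\<^sup>2) \<partial>\<nu>)
      + 2 * (\<integral>\<^sup>+p. ennreal (a (fst p)) * ennreal (b (snd p)) \<partial>M)" if M: "is_coupling \<mu> \<nu> M" for M
  proof -
    have [measurable_cong]: "sets M = sets borel" using M by (auto simp: is_coupling_def)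
    show ?thesis unfolding cost_def
      by (simp add: nn_integral_add nn_integral_cmult
          nn_integral_coupling_fst[OF M, of "\<lambda>w. ennreal ((a w)\<^sup>2)"]
          nn_integral_coupling_snd[OF M, of "\<lambda>w. ennreal ((b w)\<^sup>2)"])
  qed
  \<comment> \<open>Separation by \<open>c\<close> is a condition on each marginal separately, so it
    carries over from \<open>L\<close> to the competitor \<open>G\<close>.\<close>
  have aL: "AE p in L. 0 \<le> a (fst p)" and bL: "AE p in L. 0 \<le> b (snd p)"
    using S by (auto simp: a_def b_def dest: sep elim!: eventually_mono)
  have "AE p in G. 0 \<le> a (fst p)"
    using aL unfolding AE_coupling_fst[OF L, of "\<lambda>w. 0 \<le> a w", simplified] AE_coupling_fst[OF G, of "\<lambda>w. 0 \<le> a w", simplified] .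
  moreover have "AE p in G. 0 \<le> b (snd p)"
    using bL unfolding AE_coupling_snd[OF L, of "\<lambda>w. 0 \<le> b w", simplified] AE_coupling_snd[OF G, of "\<lambda>w. 0 \<le> b w", simplified] .
  ultimately have G_cost: "AE p in G. ennreal ((e \<bullet> (snd p - fst p))\<^sup>2) = cost p"
    by eventually_elim (rule cost_eq)
  have "AE p in L. ennreal ((norm (snd p - fst p))\<^sup>2) = cost p"
    using S
  proof eventually_elim
    case (elim p)
    obtain r where "snd p - fst p = r *\<^sub>R e" using dir[OF elim] by auto
    then have "(norm (snd p - fst p))\<^sup>2 = (e \<bullet> (snd p - fst p))\<^sup>2"
      using e by (simp add: dot_square_norm)
    then show ?case using cost_eq[of p] sep[OF elim] by (simp add: a_def b_def)
  qed
  then have "(\<integral>\<^sup>+p. ennreal ((norm (snd p - fst p))\<^sup>2) \<partial>L) = (\<integral>\<^sup>+p. cost p \<partial>L)"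
    by (rule nn_integral_cong_AE)
  \<comment> \<open>Since \<open>a\<close> reverses the order along \<open>e\<close> and
    \<open>b\<close> preserves it, a monotone support is antitone for the pair \<open>a\<close>,
    \<open>b\<close>.\<close>
  also have "\<dots> \<le> (\<integral>\<^sup>+p. cost p \<partial>G)"
    unfolding int[OF L] int[OF G]
    by (intro add_left_mono mult_left_mono antitone_coupling_minimises_product[OF L G _ _ S])
      (auto simp: a_def b_def dest: mono)
  also have "\<dots> = (\<integral>\<^sup>+p. ennreal ((e \<bullet> (snd p - fst p))\<^sup>2) \<partial>G)"
    using G_cost by (intro nn_integral_cong_AE) auto
  \<comment> \<open>The displacement under \<open>G\<close> need not be parallel to
    \<open>e\<close>; projecting onto \<open>e\<close> can only lower its norm.\<close>
  also have "\<dots> \<le> (\<integral>\<^sup>+p. ennreal ((norm (snd p - fst p))\<^sup>2) \<partial>G)"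
  proof (intro nn_integral_mono ennreal_leI)
    fix p :: "'a \<times> 'a"
    show "(e \<bullet> (snd p - fst p))\<^sup>2 \<le> (norm (snd p - fst p))\<^sup>2"
      using Cauchy_Schwarz_ineq[of e "snd p - fst p"] e by (simp add: dot_square_norm)
  qed
  finally show "(\<integral>\<^sup>+p. ennreal ((norm (snd p - fst p))\<^sup>2) \<partial>L)
      \<le> (\<integral>\<^sup>+p. ennreal ((norm (snd p - fst p))\<^sup>2) \<partial>G)" .
qed

section \<open>The one-dimensional transport map\<close>

context cdf_distribution
begin

lemma measurable_quantile [measurable]: "quantile C \<in> borel_measurable borel"
proof -
  have C1: "C x \<le> 1" "0 \<le> C x" for x
    by (auto intro: cdf_bounded_prob cdf_nonneg)
  \<comment> \<open>\<open>I\<close> is the inverse already known to be measurable on (0,1).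
    Outside, the set in the infimum is \<open>UNIV\<close> for \<open>p \<le> 0\<close> and empty
    for \<open>p > 1\<close>, so \<open>quantile C\<close> is constant on both rays; 2 is an
    arbitrary representative of the second.\<close>
  have eq: "quantile C p = (if p \<in> {0<..<1} then I p
      else if p \<le> 0 then quantile C 0 else if p = 1 then quantile C 1 else quantile C 2)" for p
  proof -
    have "{z. p \<le> C z} = {z. 0 \<le> C z}" if "p \<le> 0" using C1 that by (auto intro: order_trans)
    moreover have "{z. p \<le> C z} = {z. 2 \<le> C z}" if "p > 1"
    proof -
      have "\<not> p \<le> C z" "\<not> 2 \<le> C z" for z using C1[of z] that by linarith+
      then show ?thesis by simp
    qed
    ultimately show ?thesis by (auto simp: quantile_def)
  qed
  have "(\<lambda>p. if p \<in> {0<..<1} then I p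
      else if p \<le> 0 then quantile C 0 else if p = 1 then quantile C 1 else quantile C 2)
      \<in> borel_measurable borel"
  proof (subst measurable_If_restrict_space_iff, simp, intro conjI)
    show "I \<in> borel_measurable (restrict_space borel {x. x \<in> {0<..<1}})"
      using measurable_CI by (simp only: Collect_mem_eq)
    show "(\<lambda>p::real. if p \<le> 0 then quantile C 0 else if p = 1 then quantile C 1 else quantile C 2)
        \<in> borel_measurable (restrict_space borel {x. x \<notin> {0<..<1}})"
      by (intro measurable_restrict_space1) measurable
  qed
  then show ?thesis unfolding eq[symmetric] .
qed

lemma cdf_attains:
  assumes atomless: "\<And>x. measure M {x} = 0" and p: "0 < p" "p < 1"
  obtains w where "C w = p"
proof -
  obtain a where a: "C a < p"
    using eventually_happens'[OF trivial_limit_at_bot_linorder order_tendstoD(2)[OF bot p(1)]] by auto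
  obtain b where b: "p < C b"
    using eventually_happens'[OF trivial_limit_at_top_linorder order_tendstoD(1)[OF top p(2)]] by auto
  have "a \<le> b" using a b mono by (meson linorder_le_cases monoD not_le order_trans)
  then obtain w where "C w = p"
    using IVT[of C a p b] a b atomless isCont_cdf by auto
  then show thesis by (rule that)
qed

lemma probability_integral_transform:
  assumes atomless: "\<And>x. measure M {x} = 0" and p: "0 \<le> p" "p \<le> 1"
  shows "prob {w. C w \<le> p} = p"
proof (rule antisym)
  have meas: "{w. C w \<le> p} \<in> events" by measurable
  show "prob {w. C w \<le> p} \<le> p"
  proof (cases "p = 1")
    case False
    then have "p < 1" using p by simp
    \<comment> \<open>\<open>C\<close> may be flat at level \<open>p\<close>, so a point with
      \<open>C w = p\<close> need not bound the event. A point at a slightly higher level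
      \<open>q\<close> does, and \<open>q\<close> then decreases to \<open>p\<close>.\<close>
    show ?thesis
    proof (rule dense_ge_bounded[OF \<open>p < 1\<close>])
      fix q assume q: "p < q" "q < 1"
      obtain w where w: "C w = q" using cdf_attains[OF atomless, of q] p q by auto
      have "{w. C w \<le> p} \<subseteq> {..w}"
        using q w mono by (auto simp: mono_def) (meson linorder_le_cases not_le order_trans)
      then have "prob {w. C w \<le> p} \<le> prob {..w}" by (intro finite_measure_mono) auto
      then show "prob {w. C w \<le> p} \<le> q" using w by (simp add: cdf_def)
    qed
  qed simp
  show "p \<le> prob {w. C w \<le> p}"
  proof -
    consider "p = 0" | "p = 1" | "0 < p" "p < 1" using p by linarith
    then show ?thesis
    proof cases
      case 2
      then have "{w. C w \<le> p} = space M" using cdf_bounded_prob by auto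
      then show ?thesis using 2 prob_space by simp
    next
      case 3
      then obtain w where w: "C w = p" using cdf_attains[OF atomless] by auto
      have "{..w} \<subseteq> {w. C w \<le> p}" using w mono by (auto simp: mono_def)
      then have "prob {..w} \<le> prob {w. C w \<le> p}" using meas by (intro finite_measure_mono) auto
      then show ?thesis using w by (simp add: cdf_def)
    qed simp
  qed
qed

text \<open>The transform at level 0 excludes \<open>C w = 0\<close>; letting the level tend to 1
  from below excludes \<open>C w = 1\<close>. The inverse property of the quantile function is
  available strictly between these values.\<close>

lemma AE_cdf_strictly_between:
  assumes atomless: "\<And>x. measure M {x} = 0"
  shows "AE w in M. 0 < C w \<and> C w < 1"
proof -
  have "prob {w. C w \<le> 0} = 0" by (rule probability_integral_transform[OF atomless]) auto
  then have "AE w in M. w \<notin> {w. C w \<le> 0}" by (subst (asm) prob_eq_0) auto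
  moreover have "1 \<le> prob {w. C w < 1}"
  proof (rule dense_le_bounded[of 0])
    fix p :: real assume p: "0 < p" "p < 1"
    then have "prob {w. C w \<le> p} \<le> prob {w. C w < 1}" by (intro finite_measure_mono) auto
    then show "p \<le> prob {w. C w < 1}" using probability_integral_transform[OF atomless, of p] p by simp
  qed simp
  then have "prob {w. C w < 1} = 1" using prob_le_1[of "{w. C w < 1}"] by simp
  then have "AE w in M. w \<in> {w. C w < 1}" by (subst (asm) prob_eq_1) auto
  ultimately show ?thesis by eventually_elim auto
qed

end

text \<open>Almost surely \<open>quantile (cdf N) (cdf M w) \<le> z\<close> is equivalent to
  \<open>cdf M w \<le> cdf N z\<close>, and \<open>cdf M w\<close> is uniformly distributed, so the
  image has the distribution function of \<open>N\<close>.\<close>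

lemma distr_quantile_cdf:
  assumes "real_distribution M" "real_distribution N" and atomless: "\<And>x. measure M {x} = 0"
  shows "distr M borel (\<lambda>w. quantile (cdf N) (cdf M w)) = N"
proof -
  interpret M: cdf_distribution M using assms by (simp add: cdf_distribution_def)
  interpret N: cdf_distribution N using assms by (simp add: cdf_distribution_def)
  show ?thesis
  proof (intro cdf_unique ext)
    fix z
    have "cdf (distr M borel (\<lambda>w. quantile (cdf N) (cdf M w))) z
        = M.prob {w. quantile (cdf N) (cdf M w) \<le> z}"
      unfolding cdf_def2[of "distr _ _ _"] by (subst measure_distr) (auto simp: vimage_def)
    also have "\<dots> = M.prob {w. cdf M w \<le> cdf N z}"
    proof (rule M.finite_measure_eq_AE)
      show "AE w in M. w \<in> {w. quantile (cdf N) (cdf M w) \<le> z} \<longleftrightarrow> w \<in> {w. cdf M w \<le> cdf N z}"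
        using M.AE_cdf_strictly_between[OF atomless]
        by eventually_elim (simp add: quantile_def N.pseudoinverse[symmetric])
    qed auto
    also have "\<dots> = cdf N z"
      by (intro M.probability_integral_transform atomless N.cdf_nonneg N.cdf_bounded_prob)
    finally show "cdf (distr M borel (\<lambda>w. quantile (cdf N) (cdf M w))) z = cdf N z" .
  qed (use assms in \<open>auto intro!: M.real_distribution_distr\<close>)
qed

section \<open>Probability laws with a density proportional to a weight\<close>

lemma pos_on_interval_not_AE_zero:
  fixes f :: "real \<Rightarrow> real"
  assumes "a < b" and pos: "\<And>z. a < z \<Longrightarrow> z < b \<Longrightarrow> z \<in> A \<and> 0 < f z"
  shows "\<not> (AE z in lborel. z \<in> A \<longrightarrow> f z \<le> 0)"
proof
  assume "AE z in lborel. z \<in> A \<longrightarrow> f z \<le> 0"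
  then have "AE z in lborel. z \<notin> {a<..<b}"
    by eventually_elim (use pos in force)
  then have "emeasure lborel {a<..<b} = 0"
    by (subst (asm) AE_iff_measurable[OF _ refl]) (auto simp: Collect_conv_if greaterThanLessThan_def greaterThan_def lessThan_def Collect_conj_eq)
  then show False using \<open>a < b\<close> by simp
qed

text \<open>The interval \<open>(a, b)\<close> witnesses that the weight has positive integral, so
  that normalisation yields a probability measure.\<close>

locale law_from_weight =
  fixes f :: "real \<Rightarrow> real" and a b :: real
  assumes nonneg: "\<And>z. 0 \<le> f z" and integrable: "integrable lborel f"
    and pos_on: "a < b" "\<And>z. a < z \<Longrightarrow> z < b \<Longrightarrow> 0 < f z"
begin

lemma borel_measurable_weight [measurable]: "f \<in> borel_measurable borel"
  using borel_measurable_integrable[OF integrable] by simp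

lemma total_pos: "0 < (LINT s|lborel. f s)"
proof -
  have "\<not> (AE z in lborel. f z = 0)"
  proof
    assume "AE z in lborel. f z = 0"
    then have "AE z in lborel. z \<in> UNIV \<longrightarrow> f z \<le> 0" by eventually_elim simp
    then show False using pos_on_interval_not_AE_zero[of a b UNIV f] pos_on by blast
  qed
  then have "(LINT s|lborel. f s) \<noteq> 0"
    using integral_nonneg_eq_0_iff_AE[OF integrable] nonneg by simp
  moreover have "0 \<le> (LINT s|lborel. f s)" using nonneg by simp
  ultimately show ?thesis by simp
qed

lemma real_distribution_law: "real_distribution (law_proportional_to f)"
proof -
  have "prob_space (law_proportional_to f)"
  proof
    have "(\<integral>\<^sup>+z. ennreal (f z / (LINT s|lborel. f s)) \<partial>lborel) = ennreal (LINT z|lborel. f z / (LINT s|lborel. f s))"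
      using integrable nonneg by (intro nn_integral_eq_integral) auto
    then show "emeasure (law_proportional_to f) (space (law_proportional_to f)) = 1"
      using total_pos by (simp add: law_proportional_to_def emeasure_density)
  qed
  then show ?thesis by (intro real_distribution.intro real_distribution_axioms.intro) (auto simp: law_proportional_to_def)
qed

sublocale law: real_distribution "law_proportional_to f"
  by (rule real_distribution_law)

lemma prob_eq_0_iff:
  assumes "A \<in> sets borel"
  shows "law.prob A = 0 \<longleftrightarrow> (AE z in lborel. z \<in> A \<longrightarrow> f z \<le> 0)"
proof -
  have "law.prob A = 0 \<longleftrightarrow> A \<in> null_sets (law_proportional_to f)"
    using assms by (auto simp: law.emeasure_eq_measure null_sets_def)
  also have "\<dots> \<longleftrightarrow> (AE z in lborel. z \<in> A \<longrightarrow> f z \<le> 0)"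
    unfolding law_proportional_to_def using assms total_pos
    by (subst null_sets_density_iff) (auto simp: divide_le_0_iff ennreal_eq_0_iff)
  finally show ?thesis .
qed

lemma atomless: "law.prob {x} = 0"
  by (rule iffD2[OF prob_eq_0_iff], simp, rule eventually_mono[OF AE_lborel_singleton[of x]]) auto

lemma nn_integral_law:
  assumes [measurable]: "h \<in> borel_measurable borel"
  shows "(\<integral>\<^sup>+z. ennreal (f z) * h z \<partial>lborel) = ennreal (LINT s|lborel. f s) * (\<integral>\<^sup>+z. h z \<partial>law_proportional_to f)"
proof -
  have "ennreal (f z) = ennreal (LINT s|lborel. f s) * ennreal (f z / (LINT s|lborel. f s))" for z
    using total_pos nonneg[of z] by (simp add: ennreal_mult[symmetric])
  then show ?thesis
    by (simp add: law_proportional_to_def nn_integral_density nn_integral_cmult[symmetric] mult.assoc)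
qed

end

section \<open>Residuals of two Gaussians with equal variance and the map between them\<close>

lemma normal_density_less_iff:
  assumes "\<sigma> > 0" "u < v"
  shows "normal_density v \<sigma> z < normal_density u \<sigma> z \<longleftrightarrow> z < (u + v) / 2"
proof -
  have "normal_density v \<sigma> z < normal_density u \<sigma> z \<longleftrightarrow> (z - u)\<^sup>2 < (z - v)\<^sup>2"
    using assms by (auto simp: normal_density_def divide_less_cancel zero_less_mult_iff mult_less_0_iff)
  also have "\<dots> \<longleftrightarrow> 0 < (z - v)\<^sup>2 - (z - u)\<^sup>2"
    by simp
  \<comment> \<open>The quadratic terms cancel because the variances agree, which leaves a single
    crossing point at the midpoint.\<close>
  also have "(z - v)\<^sup>2 - (z - u)\<^sup>2 = 2 * (v - u) * ((u + v) / 2 - z)"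
    by (simp add: power2_eq_square field_simps)
  also have "0 < \<dots> \<longleftrightarrow> z < (u + v) / 2"
    using assms by (simp add: zero_less_mult_iff)
  finally show ?thesis .
qed

text \<open>Reflection at the origin turns this into the preceding comparison for
  \<open>- v < - u\<close>.\<close>

lemma normal_density_less_iff':
  assumes "\<sigma> > 0" "u < v"
  shows "normal_density u \<sigma> z < normal_density v \<sigma> z \<longleftrightarrow> (u + v) / 2 < z"
proof -
  have neg: "normal_density (- c) \<sigma> (- z) = normal_density c \<sigma> z" for c
    by (simp add: normal_density_def power2_eq_square algebra_simps)
  show ?thesis
    using normal_density_less_iff[of \<sigma> "- v" "- u" "- z"] assms unfolding neg
    by (simp add: field_simps)
qed

text \<open>The order \<open>u < v\<close> is the case that occurs: along \<open>e\<close> the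
  difference of the two means is \<open>norm (y - x)\<close>.\<close>

context
  fixes u v \<sigma> :: real
  assumes \<sigma>: "\<sigma> > 0" and uv: "u < v"
begin

lemma residual_weight_pos_iff:
  "0 < max 0 (normal_density u \<sigma> z - normal_density v \<sigma> z) \<longleftrightarrow> z < (u + v) / 2"
  "0 < max 0 (normal_density v \<sigma> z - normal_density u \<sigma> z) \<longleftrightarrow> (u + v) / 2 < z"
  using normal_density_less_iff[OF \<sigma> uv, of z] normal_density_less_iff'[OF \<sigma> uv, of z]
  by linarith+

interpretation U: law_from_weight "\<lambda>z. max 0 (normal_density u \<sigma> z - normal_density v \<sigma> z)"
    "(u + v) / 2 - 1" "(u + v) / 2"
proof
  show "integrable lborel (\<lambda>z. max 0 (normal_density u \<sigma> z - normal_density v \<sigma> z))"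
    using \<sigma> by auto
qed (simp, linarith, simp only: residual_weight_pos_iff)

interpretation V: law_from_weight "\<lambda>z. max 0 (normal_density v \<sigma> z - normal_density u \<sigma> z)"
    "(u + v) / 2" "(u + v) / 2 + 1"
proof
  show "integrable lborel (\<lambda>z. max 0 (normal_density v \<sigma> z - normal_density u \<sigma> z))"
    using \<sigma> by auto
qed (simp, linarith, simp only: residual_weight_pos_iff)

interpretation CU: cdf_distribution "law_proportional_to (\<lambda>z. max 0 (normal_density u \<sigma> z - normal_density v \<sigma> z))"
  by (rule cdf_distribution.intro[OF U.real_distribution_law])

interpretation CV: cdf_distribution "law_proportional_to (\<lambda>z. max 0 (normal_density v \<sigma> z - normal_density u \<sigma> z))"
  by (rule cdf_distribution.intro[OF V.real_distribution_law])

lemma residual_cdf_pos: "0 < residual_cdf u v \<sigma> w"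
proof -
  have "\<not> (AE z in lborel. z \<in> {..w} \<longrightarrow> max 0 (normal_density u \<sigma> z - normal_density v \<sigma> z) \<le> 0)"
    \<comment> \<open>The unit interval ending at the smaller of \<open>w\<close> and the midpoint
      lies in \<open>{..w}\<close> and carries positive weight.\<close>
    by (rule pos_on_interval_not_AE_zero[of "min w ((u + v) / 2) - 1" "min w ((u + v) / 2)"])
      (linarith, simp only: residual_weight_pos_iff min_less_iff_conj atMost_iff less_imp_le simp_thms)
  then show ?thesis
    using U.prob_eq_0_iff[of "{..w}"] by (simp add: residual_cdf_def cdf_def zero_less_measure_iff)
qed

lemma residual_cdf_less_1:
  assumes "w < (u + v) / 2"
  shows "residual_cdf u v \<sigma> w < 1"
proof -
  have "\<not> (AE z in lborel. z \<in> {w<..} \<longrightarrow> max 0 (normal_density u \<sigma> z - normal_density v \<sigma> z) \<le> 0)"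
    by (rule pos_on_interval_not_AE_zero[OF assms]) (simp only: residual_weight_pos_iff greaterThan_iff simp_thms)
  then have "0 < U.law.prob {w<..}"
    using U.prob_eq_0_iff[of "{w<..}"] by (simp add: zero_less_measure_iff)
  moreover have "{w<..} = space (law_proportional_to (\<lambda>z. max 0 (normal_density u \<sigma> z - normal_density v \<sigma> z))) - {..w}"
    by auto
  ultimately show ?thesis
    using U.law.prob_compl[of "{..w}"] by (simp add: residual_cdf_def cdf_def)
qed

lemma residual_cdf_midpoint: "residual_cdf v u \<sigma> ((u + v) / 2) = 0"
proof -
  have "max 0 (normal_density v \<sigma> z - normal_density u \<sigma> z) \<le> 0" if "z \<le> (u + v) / 2" for z
    unfolding not_less[symmetric] residual_weight_pos_iff using that by simp
  then show ?thesis
    unfolding residual_cdf_def cdf_def by (subst V.prob_eq_0_iff) auto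
qed

text \<open>Left of the midpoint the source distribution function lies strictly between 0 and 1,
  where quantile and distribution function form a Galois connection.\<close>

lemma transport_map_le_iff:
  assumes "w < (u + v) / 2"
  shows "transport_map u v \<sigma> w \<le> z \<longleftrightarrow> residual_cdf u v \<sigma> w \<le> residual_cdf v u \<sigma> z"
  using CV.pseudoinverse[of "residual_cdf u v \<sigma> w" z] residual_cdf_pos residual_cdf_less_1[OF assms]
  unfolding transport_map_def quantile_def residual_cdf_def by blast

text \<open>The target law has no mass up to the midpoint, while the source distribution function is
  already positive. This strict separation keeps moved points off the diagonal.\<close>

lemma transport_map_gt_midpoint:
  assumes "w < (u + v) / 2"
  shows "(u + v) / 2 < transport_map u v \<sigma> w"
  using transport_map_le_iff[OF assms, of "(u + v) / 2"] residual_cdf_pos[of w] residual_cdf_midpoint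
  unfolding not_le[symmetric] by simp

lemma transport_map_mono:
  assumes "w \<le> w'" "w' < (u + v) / 2"
  shows "transport_map u v \<sigma> w \<le> transport_map u v \<sigma> w'"
proof -
  have "residual_cdf u v \<sigma> w \<le> residual_cdf u v \<sigma> w'"
    unfolding residual_cdf_def using assms(1) CU.mono by (auto simp: mono_def)
  also have "\<dots> \<le> residual_cdf v u \<sigma> (transport_map u v \<sigma> w')"
    using transport_map_le_iff[OF assms(2)] by blast
  finally show ?thesis using transport_map_le_iff[of w] assms by simp
qed

lemma measurable_transport_map: "transport_map u v \<sigma> \<in> borel_measurable borel"
  unfolding transport_map_def[abs_def] residual_cdf_def
  by (intro measurable_compose[OF CU.measurable_C CV.measurable_quantile])

lemma distr_transport_map:
  "distr (law_proportional_to (\<lambda>z. max 0 (normal_density u \<sigma> z - normal_density v \<sigma> z))) borel (transport_map u v \<sigma>)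
   = law_proportional_to (\<lambda>z. max 0 (normal_density v \<sigma> z - normal_density u \<sigma> z))"
  unfolding transport_map_def[abs_def] residual_cdf_def
  by (rule distr_quantile_cdf) (auto intro: U.real_distribution_law V.real_distribution_law U.atomless)

text \<open>The unnormalised form of the push-forward. Both densities have integral 1, so their two
  excesses have equal integrals and the normalising constants agree.\<close>

lemma nn_integral_transport_map:
  assumes [measurable]: "h \<in> borel_measurable borel"
  shows "(\<integral>\<^sup>+s. ennreal (max 0 (normal_density u \<sigma> s - normal_density v \<sigma> s)) * h (transport_map u v \<sigma> s) \<partial>lborel)
       = (\<integral>\<^sup>+s. ennreal (max 0 (normal_density v \<sigma> s - normal_density u \<sigma> s)) * h s \<partial>lborel)"
proof -
  note [measurable] = measurable_transport_map
  have "(LINT s|lborel. max 0 (normal_density u \<sigma> s - normal_density v \<sigma> s))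
      - (LINT s|lborel. max 0 (normal_density v \<sigma> s - normal_density u \<sigma> s))
      = (LINT s|lborel. max 0 (normal_density u \<sigma> s - normal_density v \<sigma> s)
      - max 0 (normal_density v \<sigma> s - normal_density u \<sigma> s))"
    by (intro Bochner_Integration.integral_diff[symmetric] U.integrable V.integrable)
  also have "\<dots> = (LINT s|lborel. normal_density u \<sigma> s - normal_density v \<sigma> s)"
    by (intro Bochner_Integration.integral_cong) auto
  also have "\<dots> = 0" using \<sigma> by (subst Bochner_Integration.integral_diff) auto
  finally have Z: "(LINT s|lborel. max 0 (normal_density u \<sigma> s - normal_density v \<sigma> s))
      = (LINT s|lborel. max 0 (normal_density v \<sigma> s - normal_density u \<sigma> s))" by simp
  have "(\<integral>\<^sup>+s. h s \<partial>law_proportional_to (\<lambda>z. max 0 (normal_density v \<sigma> z - normal_density u \<sigma> z)))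
     = (\<integral>\<^sup>+s. h (transport_map u v \<sigma> s) \<partial>law_proportional_to (\<lambda>z. max 0 (normal_density u \<sigma> z - normal_density v \<sigma> z)))"
    unfolding distr_transport_map[symmetric]
    by (subst nn_integral_distr) (auto simp: law_proportional_to_def)
  then show ?thesis
    by (subst U.nn_integral_law, measurable, subst V.nn_integral_law, measurable) (simp add: Z)
qed

end

section \<open>Isotropic Gaussian densities along a direction\<close>

lemma nn_integral_lborel_translate:
  fixes f :: "'a::euclidean_space \<Rightarrow> ennreal"
  assumes [measurable]: "f \<in> borel_measurable borel"
  shows "(\<integral>\<^sup>+z. f (c + z) \<partial>lborel) = (\<integral>\<^sup>+z. f z \<partial>lborel)"
  using nn_integral_distr[of "(+) c" lborel borel f] by (simp add: lborel_distr_plus)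

text \<open>The map \<open>(s, z) \<mapsto> (e \<bullet> z, z + (s - e \<bullet> z) e)\<close> exchanges \<open>s\<close> with the \<open>e\<close>-coordinate of \<open>z\<close>. Being a
  composition of shears and of a sign change, it preserves Lebesgue measure.\<close>

lemma nn_integral_exchange_coordinate:
  fixes h :: "real \<Rightarrow> 'a::euclidean_space \<Rightarrow> ennreal"
  assumes [measurable]: "case_prod h \<in> borel_measurable (borel \<Otimes>\<^sub>M borel)" and e: "norm e = 1"
  shows "(\<integral>\<^sup>+z. \<integral>\<^sup>+s. h (e \<bullet> z) (z + (s - e \<bullet> z) *\<^sub>R e) \<partial>lborel \<partial>lborel) = (\<integral>\<^sup>+z. \<integral>\<^sup>+s. h s z \<partial>lborel \<partial>lborel)"
proof -
  have ee: "e \<bullet> e = 1" using e by (simp add: dot_square_norm)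
  have "(\<integral>\<^sup>+z. \<integral>\<^sup>+s. h (e \<bullet> z) (z + (s - e \<bullet> z) *\<^sub>R e) \<partial>lborel \<partial>lborel)
      = (\<integral>\<^sup>+z. \<integral>\<^sup>+s. h (e \<bullet> z) (z + s *\<^sub>R e) \<partial>lborel \<partial>lborel)"
  proof (rule nn_integral_cong)
    fix z
    show "(\<integral>\<^sup>+s. h (e \<bullet> z) (z + (s - e \<bullet> z) *\<^sub>R e) \<partial>lborel) = (\<integral>\<^sup>+s. h (e \<bullet> z) (z + s *\<^sub>R e) \<partial>lborel)"
      using nn_integral_lborel_translate[of "\<lambda>s. h (e \<bullet> z) (z + s *\<^sub>R e)" "- (e \<bullet> z)"] by simp
  qed
  also have "\<dots> = (\<integral>\<^sup>+s. \<integral>\<^sup>+z. h (e \<bullet> z) (z + s *\<^sub>R e) \<partial>lborel \<partial>lborel)"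
    by (intro lborel_pair.Fubini') measurable
  \<comment> \<open>Translating \<open>z\<close> by \<open>s *\<^sub>R e\<close> changes
    \<open>e \<bullet> z\<close> by exactly \<open>s\<close>, since \<open>e\<close> is a unit
    vector.\<close>
  also have "\<dots> = (\<integral>\<^sup>+s. \<integral>\<^sup>+z. h (e \<bullet> z - s) z \<partial>lborel \<partial>lborel)"
  proof (rule nn_integral_cong)
    fix s :: real
    show "(\<integral>\<^sup>+z. h (e \<bullet> z) (z + s *\<^sub>R e) \<partial>lborel) = (\<integral>\<^sup>+z. h (e \<bullet> z - s) z \<partial>lborel)"
      using nn_integral_lborel_translate[of "\<lambda>z. h (e \<bullet> z - s) z" "s *\<^sub>R e"]
      by (simp add: inner_add_right ee add.commute)
  qed
  also have "\<dots> = (\<integral>\<^sup>+z. \<integral>\<^sup>+s. h (e \<bullet> z - s) z \<partial>lborel \<partial>lborel)"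
    by (intro lborel_pair.Fubini'[symmetric]) measurable
  also have "\<dots> = (\<integral>\<^sup>+z. \<integral>\<^sup>+s. h s z \<partial>lborel \<partial>lborel)"
  proof (rule nn_integral_cong)
    fix z
    show "(\<integral>\<^sup>+s. h (e \<bullet> z - s) z \<partial>lborel) = (\<integral>\<^sup>+s. h s z \<partial>lborel)"
      using nn_integral_real_affine[of "\<lambda>s. h s z" "- 1" "e \<bullet> z"] by simp
  qed
  finally show ?thesis .
qed

text \<open>This computes the law obtained by discarding the \<open>e\<close>-coordinate of a draw
  and inserting an independent one with weight \<open>a\<close>. After the exchange of coordinates
  \<open>n\<close> depends only on the discarded value and integrates to 1, while \<psi> is
  unaffected.\<close>

lemma nn_integral_replace_coordinate:
  fixes e :: "'a::euclidean_space" and a n :: "real \<Rightarrow> ennreal" and \<psi> G :: "'a \<Rightarrow> ennreal"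
  assumes e: "norm e = 1"
    and [measurable]: "a \<in> borel_measurable borel" "n \<in> borel_measurable borel"
      "\<psi> \<in> borel_measurable borel" "G \<in> borel_measurable borel"
    and n: "(\<integral>\<^sup>+s. n s \<partial>lborel) = 1" and \<psi>: "\<And>z r. \<psi> (z + r *\<^sub>R e) = \<psi> z"
  shows "(\<integral>\<^sup>+s. a s * (\<integral>\<^sup>+z. n (e \<bullet> z) * \<psi> z * G (s *\<^sub>R e + (z - (e \<bullet> z) *\<^sub>R e)) \<partial>lborel) \<partial>lborel)
    = (\<integral>\<^sup>+w. a (e \<bullet> w) * \<psi> w * G w \<partial>lborel)"
proof -
  define h where "h s z = a s * (n (e \<bullet> z) * \<psi> z * G (s *\<^sub>R e + (z - (e \<bullet> z) *\<^sub>R e)))" for s z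
  have [measurable]: "case_prod h \<in> borel_measurable (borel \<Otimes>\<^sub>M borel)"
    unfolding h_def by measurable
  have ee: "e \<bullet> e = 1" using e by (simp add: dot_square_norm)
  have "(\<integral>\<^sup>+s. a s * (\<integral>\<^sup>+z. n (e \<bullet> z) * \<psi> z * G (s *\<^sub>R e + (z - (e \<bullet> z) *\<^sub>R e)) \<partial>lborel) \<partial>lborel)
      = (\<integral>\<^sup>+s. \<integral>\<^sup>+z. h s z \<partial>lborel \<partial>lborel)"
    unfolding h_def by (intro nn_integral_cong nn_integral_cmult[symmetric]) measurable
  also have "\<dots> = (\<integral>\<^sup>+z. \<integral>\<^sup>+s. h s z \<partial>lborel \<partial>lborel)"
    by (intro lborel_pair.Fubini'[symmetric]) measurable
  also have "\<dots> = (\<integral>\<^sup>+z. \<integral>\<^sup>+s. h (e \<bullet> z) (z + (s - e \<bullet> z) *\<^sub>R e) \<partial>lborel \<partial>lborel)"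
    by (rule nn_integral_exchange_coordinate[symmetric]) (use e in measurable)
  also have "\<dots> = (\<integral>\<^sup>+z. \<integral>\<^sup>+s. a (e \<bullet> z) * \<psi> z * G z * n s \<partial>lborel \<partial>lborel)"
  proof -
    have "h (e \<bullet> z) (z + (s - e \<bullet> z) *\<^sub>R e) = a (e \<bullet> z) * \<psi> z * G z * n s" for z s
    proof -
      have s: "e \<bullet> (z + (s - e \<bullet> z) *\<^sub>R e) = s" by (simp add: inner_add_right ee)
      have z: "(e \<bullet> z) *\<^sub>R e + (z + (s - e \<bullet> z) *\<^sub>R e - s *\<^sub>R e) = z" by (simp add: algebra_simps)
      show ?thesis unfolding h_def s \<psi> z by (simp only: mult_ac)
    qed
    then show ?thesis by simp
  qed
  also have "\<dots> = (\<integral>\<^sup>+w. a (e \<bullet> w) * \<psi> w * G w \<partial>lborel)"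
    by (simp add: nn_integral_cmult n)
  finally show ?thesis .
qed

section \<open>Factorisation of the isotropic Gaussian density\<close>

lemma matrix_inv_scaled_identity:
  fixes k :: real
  assumes "k \<noteq> 0"
  shows "matrix_inv (k *\<^sub>R mat 1 :: real^'n^'n) = (1 / k) *\<^sub>R mat 1"
proof -
  let ?A = "k *\<^sub>R mat 1 :: real^'n^'n"
  have "?A ** ((1 / k) *\<^sub>R mat 1) = mat 1" "((1 / k) *\<^sub>R mat 1) ** ?A = mat 1"
    using assms by (simp_all add: scalar_matrix_assoc[symmetric] matrix_scalar_ac)
  then have "\<exists>B. ?A ** B = mat 1 \<and> B ** ?A = mat 1" by blast
  then have "?A ** matrix_inv ?A = mat 1"
    unfolding matrix_inv_def by (rule someI2_ex) simp
  then have "k *\<^sub>R matrix_inv ?A = mat 1"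
    by (simp add: scalar_matrix_assoc[symmetric])
  then have "(1 / k) *\<^sub>R (k *\<^sub>R matrix_inv ?A) = (1 / k) *\<^sub>R mat 1" by simp
  then show ?thesis using assms by simp
qed

lemma det_scaled_identity: "det (k *\<^sub>R mat 1 :: real^'n^'n) = k ^ CARD('n)"
proof -
  have "k *\<^sub>R mat 1 = (mat k :: real^'n^'n)" by (simp add: vec_eq_iff mat_def)
  then show ?thesis using det_matrix_scaleR[of k, where 'n = 'n] by (simp only: matrix_scaleR)
qed

lemma mvn_density_isotropic:
  fixes c z :: "real^'n"
  assumes "\<sigma> > 0"
  shows "mvn_density c (\<sigma>\<^sup>2 *\<^sub>R mat 1) z
    = exp (- (norm (z - c))\<^sup>2 / (2 * \<sigma>\<^sup>2)) / sqrt (2 * pi * \<sigma>\<^sup>2) ^ CARD('n)"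
proof -
  have "(z - c) \<bullet> (matrix_inv (\<sigma>\<^sup>2 *\<^sub>R mat 1) *v (z - c)) = (norm (z - c))\<^sup>2 / \<sigma>\<^sup>2"
    using assms by (simp add: matrix_inv_scaled_identity scaleR_matrix_vector_assoc[symmetric] dot_square_norm)
  moreover have "sqrt ((2 * pi) ^ CARD('n) * (\<sigma>\<^sup>2) ^ CARD('n)) = sqrt (2 * pi * \<sigma>\<^sup>2) ^ CARD('n)"
    unfolding power_mult_distrib[symmetric] by (rule real_sqrt_power)
  ultimately show ?thesis
    unfolding mvn_density_def det_scaled_identity by simp
qed

text \<open>The factorisation over the standard basis reduces the total mass to one-dimensional
  integrals.\<close>

lemma mvn_density_eq_prod:
  fixes c z :: "real^'n"
  assumes "\<sigma> > 0"
  shows "mvn_density c (\<sigma>\<^sup>2 *\<^sub>R mat 1) z = (\<Prod>b\<in>Basis. normal_density (c \<bullet> b) \<sigma> (z \<bullet> b))"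
proof -
  have "(norm (z - c))\<^sup>2 = (\<Sum>b\<in>Basis. (z \<bullet> b - c \<bullet> b)\<^sup>2)"
    unfolding dot_square_norm[symmetric]
    by (subst euclidean_inner) (simp add: inner_diff_left power2_eq_square)
  then show ?thesis
    unfolding mvn_density_isotropic[OF assms] normal_density_def
    by (simp add: prod.distrib prod_dividef exp_sum[symmetric] sum_divide_distrib sum_negf prod_constant)
qed

lemma borel_measurable_mvn_density [measurable]:
  "mvn_density c (\<Sigma> :: real^'n^'n) \<in> borel_measurable borel"
  unfolding mvn_density_def[abs_def]
proof -
  have [measurable]: "(*v) A \<in> borel_measurable borel" for A :: "real^'n^'n"
    by (intro borel_measurable_continuous_onI matrix_vector_mult_linear_continuous_on)
  show "(\<lambda>z. exp (- ((z - c) \<bullet> (matrix_inv \<Sigma> *v (z - c))) / 2) / sqrt ((2 * pi) ^ CARD('n) * det \<Sigma>))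
      \<in> borel_measurable borel"
    by measurable
qed

lemma nn_integral_mvn_density:
  fixes c :: "real^'n"
  assumes "\<sigma> > 0"
  shows "(\<integral>\<^sup>+z. ennreal (mvn_density c (\<sigma>\<^sup>2 *\<^sub>R mat 1) z) \<partial>lborel) = 1"
proof -
  have 1: "(\<integral>\<^sup>+s. ennreal (normal_density u \<sigma> s) \<partial>lborel) = 1" for u
    using assms by (subst nn_integral_eq_integral) auto
  show ?thesis
    unfolding mvn_density_eq_prod[OF assms]
    by (simp add: prod_ennreal[symmetric] 1
        nn_integral_lborel_prod[where f = "\<lambda>b s. ennreal (normal_density (c \<bullet> b) \<sigma> s)"])
qed

text \<open>This is the Gaussian density of the component orthogonal to \<open>e\<close>, read as a
  function on the whole space. The numerator \<open>sqrt (2 * pi * \<sigma>\<^sup>2)\<close> removes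
  one normalising factor without a subtraction in the exponent.\<close>

definition transverse_density :: "real^'n \<Rightarrow> real \<Rightarrow> real^'n \<Rightarrow> real^'n \<Rightarrow> real" where
  "transverse_density e \<sigma> c z =
     exp (- (norm ((z - c) - (e \<bullet> (z - c)) *\<^sub>R e))\<^sup>2 / (2 * \<sigma>\<^sup>2)) * sqrt (2 * pi * \<sigma>\<^sup>2) / sqrt (2 * pi * \<sigma>\<^sup>2) ^ CARD('n)"

lemma transverse_density_pos: "\<sigma> > 0 \<Longrightarrow> 0 < transverse_density e \<sigma> c z"
  by (simp add: transverse_density_def)

lemma borel_measurable_transverse_density [measurable]:
  "transverse_density e \<sigma> c \<in> borel_measurable borel"
  unfolding transverse_density_def[abs_def] by measurable

text \<open>Only components orthogonal to \<open>e\<close> enter. Invariance in the centre is what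
  gives \<open>x\<close>, \<open>y\<close> and their midpoint a common transverse factor.\<close>

lemma transverse_density_shift:
  assumes "norm e = 1"
  shows "transverse_density e \<sigma> c (z + r *\<^sub>R e) = transverse_density e \<sigma> c z"
    and "transverse_density e \<sigma> (c + r *\<^sub>R e) z = transverse_density e \<sigma> c z"
proof -
  have ee: "e \<bullet> e = 1" using assms by (simp add: dot_square_norm)
  have "z + r *\<^sub>R e - c - (e \<bullet> (z + r *\<^sub>R e - c)) *\<^sub>R e = z - c - (e \<bullet> (z - c)) *\<^sub>R e"
    "z - (c + r *\<^sub>R e) - (e \<bullet> (z - (c + r *\<^sub>R e))) *\<^sub>R e = z - c - (e \<bullet> (z - c)) *\<^sub>R e"
    by (simp_all add: inner_add_right inner_diff_right ee algebra_simps)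
  then show "transverse_density e \<sigma> c (z + r *\<^sub>R e) = transverse_density e \<sigma> c z"
    "transverse_density e \<sigma> (c + r *\<^sub>R e) z = transverse_density e \<sigma> c z"
    unfolding transverse_density_def by (simp_all only:)
qed

lemma mvn_density_split:
  fixes c z :: "real^'n"
  assumes "\<sigma> > 0" "norm e = 1"
  shows "mvn_density c (\<sigma>\<^sup>2 *\<^sub>R mat 1) z = normal_density (e \<bullet> c) \<sigma> (e \<bullet> z) * transverse_density e \<sigma> c z"
proof -
  have ee: "e \<bullet> e = 1" using assms by (simp add: dot_square_norm)
  define w where "w = z - c"
  \<comment> \<open>Pythagoras for the component along \<open>e\<close> and its orthogonal
    remainder.\<close>
  have "(norm w)\<^sup>2 = (e \<bullet> w)\<^sup>2 + (norm (w - (e \<bullet> w) *\<^sub>R e))\<^sup>2"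
    unfolding dot_square_norm[symmetric]
    by (simp add: inner_diff_left inner_diff_right ee inner_commute power2_eq_square algebra_simps)
  then have "exp (- (norm w)\<^sup>2 / (2 * \<sigma>\<^sup>2))
      = exp (- (e \<bullet> w)\<^sup>2 / (2 * \<sigma>\<^sup>2)) * exp (- (norm (w - (e \<bullet> w) *\<^sub>R e))\<^sup>2 / (2 * \<sigma>\<^sup>2))"
    by (simp add: exp_add[symmetric] diff_divide_distrib)
  then show ?thesis
    using assms(1) unfolding mvn_density_isotropic[OF assms(1)] normal_density_def transverse_density_def
    by (simp add: w_def inner_diff_right)
qed

section \<open>Maximal couplings from a transport map\<close>

text \<open>Truncation makes \<open>ennreal (p w - q w)\<close> the positive part. From
  \<open>p \<le> q + max 0 (p - q)\<close> no set gains more than \<open>z\<close>, and the set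
  where \<open>q < p\<close> gains exactly \<open>z\<close>.\<close>

lemma SUP_measure_diff_density:
  fixes p q :: "'a \<Rightarrow> real"
  assumes [measurable]: "p \<in> borel_measurable M" "q \<in> borel_measurable M"
    and nonneg: "\<And>w. 0 \<le> p w" "\<And>w. 0 \<le> q w"
    and "prob_space (density M p)" "prob_space (density M q)"
    and z: "(\<integral>\<^sup>+w. ennreal (p w - q w) \<partial>M) = ennreal z"
      "(\<integral>\<^sup>+w. ennreal (q w - p w) \<partial>M) = ennreal z"
    and "0 \<le> z"
  shows "(SUP A\<in>sets M. \<bar>measure (density M p) A - measure (density M q) A\<bar>) = z"
proof -
  interpret p: prob_space "density M p" by fact
  interpret q: prob_space "density M q" by fact
  have le: "measure (density M a) A \<le> measure (density M b) A + z"
    if [measurable]: "a \<in> borel_measurable M" "b \<in> borel_measurable M" "A \<in> sets M"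
      and "\<And>w. 0 \<le> a w" "\<And>w. 0 \<le> b w" "prob_space (density M a)" "prob_space (density M b)"
      and zab: "(\<integral>\<^sup>+w. ennreal (a w - b w) \<partial>M) = ennreal z" for a b :: "'a \<Rightarrow> real" and A
  proof -
    interpret a: prob_space "density M a" by fact
    interpret b: prob_space "density M b" by fact
    have "emeasure (density M a) A \<le> (\<integral>\<^sup>+w. ennreal (b w) * indicator A w + ennreal (a w - b w) \<partial>M)"
    proof (subst emeasure_density; (intro nn_integral_mono)?)
      fix w
      have "ennreal (a w) \<le> ennreal (b w + max 0 (a w - b w))" by (intro ennreal_leI) simp
      then show "ennreal (a w) * indicator A w \<le> ennreal (b w) * indicator A w + ennreal (a w - b w)"
        using that by (auto split: split_indicator)
    qed auto
    also have "\<dots> = emeasure (density M b) A + ennreal z"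
      by (simp add: nn_integral_add zab emeasure_density)
    finally show ?thesis using \<open>0 \<le> z\<close>
      by (simp add: a.emeasure_eq_measure b.emeasure_eq_measure ennreal_plus[symmetric] del: ennreal_plus)
  qed
  let ?A = "{w \<in> space M. q w < p w}"
  have A: "?A \<in> sets M" by measurable
  have "emeasure (density M p) ?A = (\<integral>\<^sup>+w. ennreal (q w) * indicator ?A w + ennreal (p w - q w) \<partial>M)"
    using nonneg by (subst emeasure_density)
      (auto simp: ennreal_plus[symmetric] ennreal_neg simp del: ennreal_plus intro!: nn_integral_cong split: split_indicator)
  also have "\<dots> = emeasure (density M q) ?A + ennreal z"
    by (simp add: nn_integral_add z emeasure_density)
  finally have attained: "measure (density M p) ?A = measure (density M q) ?A + z" using \<open>0 \<le> z\<close>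
    by (simp add: p.emeasure_eq_measure q.emeasure_eq_measure ennreal_plus[symmetric] del: ennreal_plus)
  show ?thesis
  proof (rule cSup_eq_maximum)
    show "z \<in> (\<lambda>A. \<bar>measure (density M p) A - measure (density M q) A\<bar>) ` sets M"
      using attained A \<open>0 \<le> z\<close> by (intro image_eqI[of _ _ ?A]) auto
  next
    fix r assume "r \<in> (\<lambda>A. \<bar>measure (density M p) A - measure (density M q) A\<bar>) ` sets M"
    then obtain A where A: "A \<in> sets M" and r: "r = \<bar>measure (density M p) A - measure (density M q) A\<bar>" by auto
    have "measure (density M p) A \<le> measure (density M q) A + z"
      "measure (density M q) A \<le> measure (density M p) A + z"
      using A assms by (auto intro!: le)
    then show "r \<le> z" unfolding r by linarith
  qed
qed

lemma nn_integral_min_plus_excess: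
  fixes a b :: "'a \<Rightarrow> real"
  assumes [measurable]: "a \<in> borel_measurable M" "b \<in> borel_measurable M" "h \<in> borel_measurable M"
    and "\<And>w. 0 \<le> a w" "\<And>w. 0 \<le> b w"
  shows "(\<integral>\<^sup>+w. ennreal (min (a w) (b w)) * h w \<partial>M) + (\<integral>\<^sup>+w. ennreal (a w - b w) * h w \<partial>M)
    = (\<integral>\<^sup>+w. ennreal (a w) * h w \<partial>M)"
proof -
  have "ennreal (min (a w) (b w)) + ennreal (a w - b w) = ennreal (a w)" for w
    using assms(4,5)[of w]
    by (cases "a w \<le> b w") (auto simp: ennreal_neg ennreal_plus[symmetric] simp del: ennreal_plus)
  then have "ennreal (min (a w) (b w)) * h w + ennreal (a w - b w) * h w = ennreal (a w) * h w" for w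
    unfolding distrib_right[symmetric] by simp
  then show ?thesis by (subst nn_integral_add[symmetric]) auto
qed

lemma borel_off_diagonal [measurable]: "{r :: 'a::euclidean_space \<times> 'a. fst r \<noteq> snd r} \<in> sets borel"
  by measurable

text \<open>The measure \<gamma> is given through its integrals, the form in which the law of a
  sampling procedure is computed. \<open>push\<close> moves the excess of \<open>p\<close> onto the
  excess of \<open>q\<close>, and \<open>moves\<close> keeps the graph part off the
  diagonal.\<close>

locale diagonal_transport_coupling =
  fixes p q :: "'a::euclidean_space \<Rightarrow> real" and T :: "'a \<Rightarrow> 'a" and \<gamma> :: "('a \<times> 'a) measure"
  assumes p [measurable]: "p \<in> borel_measurable borel" and q [measurable]: "q \<in> borel_measurable borel"
    and T [measurable]: "T \<in> borel_measurable borel"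
    and nonneg: "\<And>w. 0 \<le> p w" "\<And>w. 0 \<le> q w"
    and prob_p: "prob_space (density lborel p)" and prob_q: "prob_space (density lborel q)"
    and push: "\<And>h. h \<in> borel_measurable borel \<Longrightarrow>
      (\<integral>\<^sup>+w. ennreal (p w - q w) * h (T w) \<partial>lborel) = (\<integral>\<^sup>+w. ennreal (q w - p w) * h w \<partial>lborel)"
    and moves: "\<And>w. q w < p w \<Longrightarrow> T w \<noteq> w"
    and sets_\<gamma>: "sets \<gamma> = sets borel"
    and nn_integral_\<gamma>: "\<And>H. H \<in> borel_measurable borel \<Longrightarrow>
      (\<integral>\<^sup>+r. H r \<partial>\<gamma>) = (\<integral>\<^sup>+w. ennreal (min (p w) (q w)) * H (w, w) \<partial>lborel)
        + (\<integral>\<^sup>+w. ennreal (p w - q w) * H (w, T w) \<partial>lborel)"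
begin

lemma space_\<gamma>: "space \<gamma> = UNIV"
  using sets_\<gamma> by (auto dest: sets_eq_imp_space_eq)

lemma emeasure_\<gamma>:
  assumes [measurable]: "X \<in> sets borel"
  shows "emeasure \<gamma> X = (\<integral>\<^sup>+w. ennreal (min (p w) (q w)) * indicator X (w, w) \<partial>lborel)
        + (\<integral>\<^sup>+w. ennreal (p w - q w) * indicator X (w, T w) \<partial>lborel)"
  using nn_integral_\<gamma>[of "indicator X"] sets_\<gamma> assms by simp

lemma distr_fst: "distr \<gamma> borel fst = density lborel p"
proof (rule measure_eqI)
  fix A :: "'a set" assume "A \<in> sets (distr \<gamma> borel fst)"
  then have [measurable]: "A \<in> sets borel" by simp
  have "emeasure (distr \<gamma> borel fst) A = emeasure \<gamma> (fst -` A)"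
    by (subst emeasure_distr) (auto simp: measurable_cong_sets[OF sets_\<gamma> refl] space_\<gamma>)
  also have "\<dots> = (\<integral>\<^sup>+w. ennreal (p w) * indicator A w \<partial>lborel)"
    using nn_integral_min_plus_excess[where M = lborel and a = p and b = q and h = "indicator A"] nonneg
    by (subst emeasure_\<gamma>) (auto simp: indicator_vimage measurable_sets_borel[OF borel_measurable_fst_snd(1)])
  finally show "emeasure (distr \<gamma> borel fst) A = emeasure (density lborel p) A"
    by (simp add: emeasure_density)
qed simp

lemma distr_snd: "distr \<gamma> borel snd = density lborel q"
proof (rule measure_eqI)
  fix A :: "'a set" assume "A \<in> sets (distr \<gamma> borel snd)"
  then have [measurable]: "A \<in> sets borel" by simp
  have "emeasure (distr \<gamma> borel snd) A = emeasure \<gamma> (snd -` A)"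
    by (subst emeasure_distr) (auto simp: measurable_cong_sets[OF sets_\<gamma> refl] space_\<gamma>)
  also have "\<dots> = (\<integral>\<^sup>+w. ennreal (q w) * indicator A w \<partial>lborel)"
    using nn_integral_min_plus_excess[where M = lborel and a = q and b = p and h = "indicator A"] nonneg push[of "indicator A"]
    by (subst emeasure_\<gamma>) (auto simp: indicator_vimage measurable_sets_borel[OF borel_measurable_fst_snd(2)] min.commute)
  finally show "emeasure (distr \<gamma> borel snd) A = emeasure (density lborel q) A"
    by (simp add: emeasure_density)
qed simp

lemma coupling: "is_coupling (density lborel p) (density lborel q) \<gamma>"
proof -
  have "emeasure (distr \<gamma> borel fst) (space (distr \<gamma> borel fst)) = 1"
    unfolding distr_fst by (rule prob_space.emeasure_space_1[OF prob_p])
  then have "prob_space \<gamma>"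
    by (intro prob_spaceI) (simp add: emeasure_distr measurable_cong_sets[OF sets_\<gamma> refl])
  then show ?thesis using sets_\<gamma> distr_fst distr_snd by (simp add: is_coupling_def)
qed

lemma emeasure_off_diagonal:
  "emeasure \<gamma> {r. fst r \<noteq> snd r} = (\<integral>\<^sup>+w. ennreal (p w - q w) \<partial>lborel)"
proof -
  have "ennreal (p w - q w) * indicator {r. fst r \<noteq> snd r} (w, T w) = ennreal (p w - q w)" for w
    using moves[of w] by (cases "q w < p w") (auto simp: ennreal_neg)
  then show ?thesis by (subst emeasure_\<gamma>) auto
qed

lemma maximal_coupling: "is_maximal_coupling (density lborel p) (density lborel q) \<gamma>"
proof -
  interpret prob_space \<gamma> using coupling by (simp add: is_coupling_def)
  have [measurable]: "{r. fst r \<noteq> snd r} \<in> events" unfolding sets_\<gamma> by measurable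
  have z: "(\<integral>\<^sup>+w. ennreal (p w - q w) \<partial>lborel) = ennreal (prob {r. fst r \<noteq> snd r})"
    using emeasure_off_diagonal by (simp add: emeasure_eq_measure)
  \<comment> \<open>\<open>push\<close> for the constant function 1 supplies the equality of the two
    excess masses.\<close>
  then have "(SUP A\<in>sets lborel. \<bar>measure (density lborel p) A - measure (density lborel q) A\<bar>) = prob {r. fst r \<noteq> snd r}"
    using push[of "\<lambda>_. 1"] nonneg prob_p prob_q by (intro SUP_measure_diff_density) auto
  moreover have "{r. fst r = snd r} = space \<gamma> - {r. fst r \<noteq> snd r}"
    by (auto simp: space_\<gamma>)
  then have "prob {r. fst r = snd r} = 1 - prob {r. fst r \<noteq> snd r}"
    by (simp add: prob_compl)
  ultimately show ?thesis using coupling by (simp add: is_maximal_coupling_def)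
qed

lemma AE_off_diagonal_law:
  "AE r in off_diagonal_law \<gamma>. r \<in> {(w, T w) | w. q w < p w}"
proof -
  \<comment> \<open>The exceptional event is expressed by Borel functions of the two coordinates, so
    its measurability does not involve the image of the graph.\<close>
  let ?X = "{r. fst r \<noteq> snd r \<and> \<not> (snd r = T (fst r) \<and> q (fst r) < p (fst r))}"
  have X: "?X \<in> sets borel" by measurable
  have "ennreal (p w - q w) * indicator ?X (w, T w) = 0" for w
    by (cases "q w < p w") (auto simp: ennreal_neg)
  then have "emeasure \<gamma> ?X = 0"
    unfolding emeasure_\<gamma>[OF X] by (simp del: mult_eq_0_iff)
  then have "AE r in \<gamma>. r \<notin> ?X"
    using X sets_\<gamma> by (intro AE_not_in) (auto simp: null_sets_def)
  then show ?thesis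
    unfolding off_diagonal_law_def
    by (intro AE_uniform_measureI) (auto simp: sets_\<gamma> elim!: eventually_mono)
qed

text \<open>Positive off-diagonal mass is what makes conditioning on it produce a probability
  measure.\<close>

lemma coupling_residuals:
  assumes "(\<integral>\<^sup>+w. ennreal (p w - q w) \<partial>lborel) \<noteq> 0"
  shows "is_coupling (residual_fst \<gamma>) (residual_snd \<gamma>) (off_diagonal_law \<gamma>)"
proof -
  interpret prob_space \<gamma> using coupling by (simp add: is_coupling_def)
  have "prob_space (off_diagonal_law \<gamma>)"
    unfolding off_diagonal_law_def using assms
    by (intro prob_space_uniform_measure) (simp_all add: emeasure_off_diagonal[symmetric])
  then show ?thesis
    by (simp add: is_coupling_def residual_fst_def residual_snd_def off_diagonal_law_def sets_\<gamma>)
qed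

end

section \<open>The law of the sampling procedure\<close>

lemma sets_normal_law [simp, measurable_cong]: "sets (normal_law u \<sigma>) = sets borel"
  by (simp add: normal_law_def)

lemma prob_space_unif: "prob_space unif"
  unfolding unif_def by (rule prob_space_uniform_measure) auto

lemma sets_unif [simp, measurable_cong]: "sets unif = sets borel"
  by (simp add: unif_def)

lemma emeasure_unif_atMost: "0 \<le> r \<Longrightarrow> emeasure unif {..r} = ennreal (min 1 r)"
proof -
  assume "0 \<le> r"
  then have "{0..1} \<inter> {..r} = {0..min 1 r}" by auto
  then show ?thesis using \<open>0 \<le> r\<close> by (simp add: unif_def divide_ennreal_def)
qed

text \<open>Acceptance has probability \<open>min 1 r\<close>; for \<open>r > 1\<close> the
  rejection weight \<open>ennreal (1 - r)\<close> truncates to 0.\<close>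

lemma nn_integral_unif_threshold:
  assumes "0 \<le> r"
  shows "(\<integral>\<^sup>+W. (if W \<le> r then a else b) \<partial>unif) = ennreal (min 1 r) * a + ennreal (1 - r) * b"
proof -
  interpret prob_space unif by (rule prob_space_unif)
  have sp: "space unif = UNIV" by (simp add: unif_def)
  have "emeasure unif {r<..} = emeasure unif (space unif - {..r})"
    by (rule arg_cong[where f = "emeasure unif"]) (auto simp: sp)
  also have "\<dots> = 1 - ennreal (min 1 r)"
    using assms by (subst emeasure_compl) (auto simp: emeasure_space_1 emeasure_unif_atMost)
  also have "\<dots> = ennreal (1 - r)"
    using assms by (simp add: ennreal_1[symmetric] ennreal_minus ennreal_neg min_def del: ennreal_1)
  finally have upper: "emeasure unif {r<..} = ennreal (1 - r)" .
  have "(\<integral>\<^sup>+W. (if W \<le> r then a else b) \<partial>unif)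
      = (\<integral>\<^sup>+W. a * indicator {..r} W + b * indicator {r<..} W \<partial>unif)"
    by (intro nn_integral_cong) (auto split: split_indicator)
  also have "\<dots> = ennreal (min 1 r) * a + ennreal (1 - r) * b"
    using assms by (simp add: nn_integral_add nn_integral_cmult emeasure_unif_atMost upper mult.commute)
  finally show ?thesis .
qed

lemma nn_integral_MaxOT1:
  assumes \<sigma>: "\<sigma> > 0" and uv: "u < v" and [measurable]: "K \<in> borel_measurable borel"
  shows "(\<integral>\<^sup>+r. K r \<partial>MaxOT1 u v \<sigma>) =
      (\<integral>\<^sup>+s. ennreal (min (normal_density u \<sigma> s) (normal_density v \<sigma> s)) * K (s, s) \<partial>lborel)
    + (\<integral>\<^sup>+s. ennreal (normal_density u \<sigma> s - normal_density v \<sigma> s) * K (s, transport_map u v \<sigma> s) \<partial>lborel)"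
proof -
  interpret unif: prob_space unif by (rule prob_space_unif)
  note [measurable] = measurable_transport_map[OF \<sigma> uv]
  let ?f = "normal_density u \<sigma>" and ?g = "normal_density v \<sigma>" and ?t = "transport_map u v \<sigma>"
  define F where "F = (\<lambda>(u', W). (u', if W * ?f u' \<le> ?g u' then u' else ?t u'))"
  have [measurable]: "F \<in> borel_measurable (normal_law u \<sigma> \<Otimes>\<^sub>M unif)"
    unfolding F_def borel_prod[symmetric] by measurable
  \<comment> \<open>Given \<open>s\<close>, the proposal is accepted when \<open>W\<close> is at
    most \<open>?g s / ?f s\<close>. Multiplying the two resulting probabilities by
    \<open>?f s\<close> gives the minimum and the excess.\<close>
  have inner: "ennreal (?f s) * (\<integral>\<^sup>+W. K (F (s, W)) \<partial>unif)
      = ennreal (min (?f s) (?g s)) * K (s, s) + ennreal (?f s - ?g s) * K (s, ?t s)" for s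
  proof -
    have f: "0 < ?f s" using \<sigma> by (rule normal_density_pos)
    have "(\<integral>\<^sup>+W. K (F (s, W)) \<partial>unif) = (\<integral>\<^sup>+W. (if W \<le> ?g s / ?f s then K (s, s) else K (s, ?t s)) \<partial>unif)"
      using f by (intro nn_integral_cong) (simp add: F_def pos_le_divide_eq)
    also have "\<dots> = ennreal (min 1 (?g s / ?f s)) * K (s, s) + ennreal (1 - ?g s / ?f s) * K (s, ?t s)"
      by (rule nn_integral_unif_threshold) simp
    finally show ?thesis
      using f by (simp add: distrib_left mult.assoc[symmetric] ennreal_mult'[symmetric] min_mult_distrib_left right_diff_distrib)
  qed
  have "(\<integral>\<^sup>+r. K r \<partial>MaxOT1 u v \<sigma>) = (\<integral>\<^sup>+r. K (F r) \<partial>(normal_law u \<sigma> \<Otimes>\<^sub>M unif))"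
    unfolding MaxOT1_def F_def[symmetric] by (rule nn_integral_distr) measurable
  also have "\<dots> = (\<integral>\<^sup>+s. \<integral>\<^sup>+W. K (F (s, W)) \<partial>unif \<partial>normal_law u \<sigma>)"
    by (rule unif.nn_integral_fst[symmetric]) measurable
  also have "\<dots> = (\<integral>\<^sup>+s. ennreal (?f s) * (\<integral>\<^sup>+W. K (F (s, W)) \<partial>unif) \<partial>lborel)"
    unfolding normal_law_def by (rule nn_integral_density) measurable
  also have "\<dots> = (\<integral>\<^sup>+s. ennreal (min (?f s) (?g s)) * K (s, s) \<partial>lborel)
    + (\<integral>\<^sup>+s. ennreal (?f s - ?g s) * K (s, ?t s) \<partial>lborel)"
    unfolding inner by (rule nn_integral_add) measurable
  finally show ?thesis .
qed

section \<open>The procedure in dimension d\<close>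

lemma projection_matrix_vector:
  fixes e z :: "real^'n"
  shows "(mat 1 - (\<chi> i j. e $ i * e $ j)) *v z = z - (e \<bullet> z) *\<^sub>R e"
proof -
  have "(\<chi> i j. e $ i * e $ j) *v z = (e \<bullet> z) *\<^sub>R e"
    by (simp add: vec_eq_iff matrix_vector_mult_def inner_vec_def sum_distrib_left mult_ac)
  then show ?thesis by (simp add: matrix_vector_mult_diff_rdistrib)
qed

lemma prob_space_mvn_isotropic: "\<sigma> > 0 \<Longrightarrow> prob_space (mvn c (\<sigma>\<^sup>2 *\<^sub>R mat 1))"
  by (intro prob_spaceI) (simp add: mvn_def emeasure_density nn_integral_mvn_density)

lemma sets_mvn [simp, measurable_cong]: "sets (mvn c \<Sigma>) = sets borel"
  by (simp add: mvn_def)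

lemma sets_MaxOT1 [simp, measurable_cong]: "sets (MaxOT1 u v \<sigma>) = sets borel"
  by (simp add: MaxOT1_def)

text \<open>\<open>K (a, b)\<close> is the mean of \<open>H\<close> given the one-dimensional draw
  \<open>(a, b)\<close>. Its measurability is included so that the formula for \<open>MaxOT1\<close>
  can be applied to it.\<close>

lemma nn_integral_MaxOT:
  fixes x y :: "real^'n"
  assumes \<sigma>: "\<sigma> > 0" and "x \<noteq> y" and H [measurable]: "H \<in> borel_measurable borel"
  defines "e \<equiv> (y - x) /\<^sub>R norm (y - x)" and "m \<equiv> (y + x) /\<^sub>R 2"
  defines "K \<equiv> \<lambda>(a, b). \<integral>\<^sup>+z. ennreal (mvn_density m (\<sigma>\<^sup>2 *\<^sub>R mat 1) z)
      * H (a *\<^sub>R e + (z - (e \<bullet> z) *\<^sub>R e), b *\<^sub>R e + (z - (e \<bullet> z) *\<^sub>R e)) \<partial>lborel"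
  shows "K \<in> borel_measurable borel" (is ?meas)
    and "(\<integral>\<^sup>+r. H r \<partial>MaxOT x y \<sigma>) = (\<integral>\<^sup>+r. K r \<partial>MaxOT1 (e \<bullet> x) (e \<bullet> y) \<sigma>)" (is ?int)
proof -
  interpret mvn: prob_space "mvn m (\<sigma>\<^sup>2 *\<^sub>R mat 1)" using \<sigma> by (rule prob_space_mvn_isotropic)
  have H' [measurable]: "H \<in> borel_measurable (borel \<Otimes>\<^sub>M borel)"
    using H unfolding borel_prod .
  define F where "F = (\<lambda>((a, b), z). (a *\<^sub>R e + (z - (e \<bullet> z) *\<^sub>R e), b *\<^sub>R e + (z - (e \<bullet> z) *\<^sub>R e)))"
  have "F \<in> measurable ((borel \<Otimes>\<^sub>M borel) \<Otimes>\<^sub>M borel) (borel \<Otimes>\<^sub>M borel)"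
    unfolding F_def case_prod_beta by measurable
  then have [measurable]: "F \<in> measurable (borel \<Otimes>\<^sub>M borel) borel"
    unfolding borel_prod .
  show ?meas
  proof -
    have "(\<lambda>r. \<integral>\<^sup>+z. ennreal (mvn_density m (\<sigma>\<^sup>2 *\<^sub>R mat 1) z) * H (F (r, z)) \<partial>lborel) \<in> borel_measurable borel"
      by measurable
    then show ?thesis unfolding K_def F_def by (simp add: case_prod_beta)
  qed
  have "(\<integral>\<^sup>+r. H r \<partial>MaxOT x y \<sigma>) = (\<integral>\<^sup>+r. H (F r) \<partial>(MaxOT1 (e \<bullet> x) (e \<bullet> y) \<sigma> \<Otimes>\<^sub>M mvn m (\<sigma>\<^sup>2 *\<^sub>R mat 1)))"
    unfolding MaxOT_def Let_def e_def[symmetric] m_def[symmetric] projection_matrix_vector F_def[symmetric]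
    by (rule nn_integral_distr) measurable
  also have "\<dots> = (\<integral>\<^sup>+r. \<integral>\<^sup>+z. H (F (r, z)) \<partial>mvn m (\<sigma>\<^sup>2 *\<^sub>R mat 1) \<partial>MaxOT1 (e \<bullet> x) (e \<bullet> y) \<sigma>)"
    by (rule mvn.nn_integral_fst[symmetric]) measurable
  also have "\<dots> = (\<integral>\<^sup>+r. K r \<partial>MaxOT1 (e \<bullet> x) (e \<bullet> y) \<sigma>)"
  proof (rule nn_integral_cong)
    fix r
    have "(\<integral>\<^sup>+z. H (F (r, z)) \<partial>mvn m (\<sigma>\<^sup>2 *\<^sub>R mat 1))
        = (\<integral>\<^sup>+z. ennreal (mvn_density m (\<sigma>\<^sup>2 *\<^sub>R mat 1) z) * H (F (r, z)) \<partial>lborel)"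
      unfolding mvn_def by (rule nn_integral_density) measurable
    then show "(\<integral>\<^sup>+z. H (F (r, z)) \<partial>mvn m (\<sigma>\<^sup>2 *\<^sub>R mat 1)) = K r"
      by (simp add: K_def F_def case_prod_beta)
  qed
  finally show ?int .
qed

theorem lemma4p4:
  fixes x y :: "real^'n" and \<sigma> :: real
  assumes "\<sigma> > 0" and "x \<noteq> y"
  shows "is_maximal_ot_coupling (mvn x (\<sigma>\<^sup>2 *\<^sub>R mat 1)) (mvn y (\<sigma>\<^sup>2 *\<^sub>R mat 1)) (MaxOT x y \<sigma>)"
proof -
  note \<sigma> = \<open>\<sigma> > 0\<close>
  define e where "e = (y - x) /\<^sub>R norm (y - x)"
  define m where "m = (y + x) /\<^sub>R 2"
  define u v where "u = e \<bullet> x" and "v = e \<bullet> y"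
  define f g t where "f = normal_density u \<sigma>" and "g = normal_density v \<sigma>" and "t = transport_map u v \<sigma>"
  define \<psi> where "\<psi> = transverse_density e \<sigma> m"
  define p q where "p = mvn_density x (\<sigma>\<^sup>2 *\<^sub>R mat 1)" and "q = mvn_density y (\<sigma>\<^sup>2 *\<^sub>R mat 1)"
  define T where "T w = t (e \<bullet> w) *\<^sub>R e + (w - (e \<bullet> w) *\<^sub>R e)" for w
  have e: "norm e = 1" using \<open>x \<noteq> y\<close> by (simp add: e_def)
  then have ee: "e \<bullet> e = 1" by (simp add: dot_square_norm)
  obtain c where "c > 0" and y: "y = x + c *\<^sub>R e"
    using \<open>x \<noteq> y\<close> by (intro that[of "norm (y - x)"]) (simp_all add: e_def)
  have uv: "u < v"
    using \<open>c > 0\<close> unfolding u_def v_def y by (simp add: inner_add_right ee)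
  have m: "m = x + (c / 2) *\<^sub>R e"
    unfolding m_def y by (simp add: scaleR_add_right scaleR_half_double[symmetric] add.commute add.left_commute)
  \<comment> \<open>The points \<open>x\<close>, \<open>y\<close> and \<open>m\<close> differ by
    multiples of \<open>e\<close>, so the transverse draw centred at \<open>m\<close> suits both
    Gaussians.\<close>
  have \<psi>_x: "transverse_density e \<sigma> x = \<psi>" and \<psi>_y: "transverse_density e \<sigma> y = \<psi>"
    unfolding \<psi>_def m y by (simp_all add: transverse_density_shift[OF e] fun_eq_iff)
  have \<psi>_pos: "0 < \<psi> w" and \<psi>_shift: "\<psi> (w + r *\<^sub>R e) = \<psi> w" for w r
    unfolding \<psi>_def using \<sigma> e by (simp_all add: transverse_density_pos transverse_density_shift)
  have p_eq: "p w = f (e \<bullet> w) * \<psi> w" and q_eq: "q w = g (e \<bullet> w) * \<psi> w"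
    and m_eq: "mvn_density m (\<sigma>\<^sup>2 *\<^sub>R mat 1) w = normal_density (e \<bullet> m) \<sigma> (e \<bullet> w) * \<psi> w" for w
    by (simp_all add: p_def q_def f_def g_def u_def v_def mvn_density_split[OF \<sigma> e] \<psi>_x \<psi>_y \<psi>_def)
  have f_pos: "0 < f s" and g_pos: "0 < g s" for s
    using \<sigma> by (simp_all add: f_def g_def normal_density_pos)
  have [measurable]: "f \<in> borel_measurable borel" "g \<in> borel_measurable borel" "t \<in> borel_measurable borel"
    "\<psi> \<in> borel_measurable borel" "p \<in> borel_measurable borel" "q \<in> borel_measurable borel"
    unfolding f_def g_def t_def \<psi>_def p_def q_def using measurable_transport_map[OF \<sigma> uv] by measurable
  have T_meas [measurable]: "T \<in> borel_measurable borel"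
    unfolding T_def[abs_def] by measurable
  have eT: "e \<bullet> T w = t (e \<bullet> w)" for w
    by (simp add: T_def inner_add_right inner_diff_right ee)
  have min_eq: "ennreal (min (p w) (q w)) = ennreal (min (f (e \<bullet> w)) (g (e \<bullet> w))) * ennreal (\<psi> w)"
    and diff_eq: "ennreal (p w - q w) = ennreal (f (e \<bullet> w) - g (e \<bullet> w)) * ennreal (\<psi> w)"
    and diff_eq': "ennreal (q w - p w) = ennreal (g (e \<bullet> w) - f (e \<bullet> w)) * ennreal (\<psi> w)" for w
    using \<psi>_pos[of w] unfolding p_eq q_eq
    by (simp_all add: ennreal_mult''[symmetric] min_mult_distrib_right left_diff_distrib)
  have less_iff: "q w < p w \<longleftrightarrow> e \<bullet> w < (u + v) / 2" for w
    unfolding p_eq q_eq normal_density_less_iff[OF \<sigma> uv, symmetric] f_def g_def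
    using \<psi>_pos[of w] by simp
  \<comment> \<open>\<open>J k s\<close> is the mean of \<open>k\<close> at a point with
    \<open>e\<close>-coordinate \<open>s\<close> and random transverse part. It links integrals over
    the line with integrals over the space.\<close>
  define J where "J k s = (\<integral>\<^sup>+z. ennreal (mvn_density m (\<sigma>\<^sup>2 *\<^sub>R mat 1) z) * k (s *\<^sub>R e + (z - (e \<bullet> z) *\<^sub>R e)) \<partial>lborel)"
    for k s
  have J: "(\<integral>\<^sup>+s. a s * J k s \<partial>lborel) = (\<integral>\<^sup>+w. a (e \<bullet> w) * ennreal (\<psi> w) * k w \<partial>lborel)"
    if [measurable]: "a \<in> borel_measurable borel" "k \<in> borel_measurable borel" for a k
    unfolding J_def m_eq ennreal_mult''[OF less_imp_le[OF \<psi>_pos]]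
  proof (rule nn_integral_replace_coordinate[OF e])
    show "(\<integral>\<^sup>+s. ennreal (normal_density (e \<bullet> m) \<sigma> s) \<partial>lborel) = 1"
      using \<sigma> by (subst nn_integral_eq_integral) auto
  qed (simp_all add: \<psi>_shift)
  have J_meas: "J k \<in> borel_measurable borel" if [measurable]: "k \<in> borel_measurable borel" for k
    unfolding J_def[abs_def] by measurable
  have push: "(\<integral>\<^sup>+w. ennreal (p w - q w) * h (T w) \<partial>lborel) = (\<integral>\<^sup>+w. ennreal (q w - p w) * h w \<partial>lborel)"
    if [measurable]: "h \<in> borel_measurable borel" for h
  proof -
    \<comment> \<open>\<open>T\<close> alters only the \<open>e\<close>-coordinate, hence it acts on
      \<open>J\<close> through its scalar argument.\<close>
    have J_T: "J (\<lambda>w. h (T w)) s = J h (t s)" for s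
      unfolding J_def T_def by (simp add: inner_add_right inner_diff_right ee)
    have "(\<integral>\<^sup>+w. ennreal (p w - q w) * h (T w) \<partial>lborel) = (\<integral>\<^sup>+s. ennreal (f s - g s) * J (\<lambda>w. h (T w)) s \<partial>lborel)"
      unfolding diff_eq by (rule J[symmetric]) measurable
    also have "\<dots> = (\<integral>\<^sup>+s. ennreal (g s - f s) * J h s \<partial>lborel)"
      unfolding J_T using nn_integral_transport_map[OF \<sigma> uv J_meas] that
      by (simp add: f_def g_def t_def)
    also have "\<dots> = (\<integral>\<^sup>+w. ennreal (q w - p w) * h w \<partial>lborel)"
      unfolding diff_eq' by (rule J) measurable
    finally show ?thesis .
  qed
  have int: "(\<integral>\<^sup>+r. H r \<partial>MaxOT x y \<sigma>) = (\<integral>\<^sup>+w. ennreal (min (p w) (q w)) * H (w, w) \<partial>lborel)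
        + (\<integral>\<^sup>+w. ennreal (p w - q w) * H (w, T w) \<partial>lborel)"
    if H [measurable]: "H \<in> borel_measurable borel" for H
  proof -
    note [measurable] = H[folded borel_prod]
    define K where "K = (\<lambda>(a, b). \<integral>\<^sup>+z. ennreal (mvn_density m (\<sigma>\<^sup>2 *\<^sub>R mat 1) z)
      * H (a *\<^sub>R e + (z - (e \<bullet> z) *\<^sub>R e), b *\<^sub>R e + (z - (e \<bullet> z) *\<^sub>R e)) \<partial>lborel)"
    note K = nn_integral_MaxOT[OF \<sigma> \<open>x \<noteq> y\<close> H, folded e_def m_def, folded K_def u_def v_def]
    \<comment> \<open>Both outputs share one transverse part, so the pair has the form
      \<open>(w, w)\<close> after acceptance and \<open>(w, T w)\<close> after rejection.\<close>
    have K_J: "K (s, s) = J (\<lambda>w. H (w, w)) s" "K (s, t s) = J (\<lambda>w. H (w, T w)) s" for s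
      unfolding K_def J_def T_def by (simp_all add: inner_add_right inner_diff_right ee)
    have "(\<integral>\<^sup>+r. H r \<partial>MaxOT x y \<sigma>) = (\<integral>\<^sup>+s. ennreal (min (f s) (g s)) * K (s, s) \<partial>lborel)
        + (\<integral>\<^sup>+s. ennreal (f s - g s) * K (s, t s) \<partial>lborel)"
      unfolding K(2) f_def g_def t_def by (rule nn_integral_MaxOT1[OF \<sigma> uv K(1)])
    also have "(\<integral>\<^sup>+s. ennreal (min (f s) (g s)) * K (s, s) \<partial>lborel) = (\<integral>\<^sup>+w. ennreal (min (p w) (q w)) * H (w, w) \<partial>lborel)"
      unfolding K_J min_eq by (rule J) measurable
    also have "(\<integral>\<^sup>+s. ennreal (f s - g s) * K (s, t s) \<partial>lborel) = (\<integral>\<^sup>+w. ennreal (p w - q w) * H (w, T w) \<partial>lborel)"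
      unfolding K_J diff_eq by (rule J) measurable
    finally show ?thesis .
  qed
  have t_gt: "e \<bullet> w < (u + v) / 2 \<Longrightarrow> (u + v) / 2 < t (e \<bullet> w)" for w
    unfolding t_def by (rule transport_map_gt_midpoint[OF \<sigma> uv])
  interpret diagonal_transport_coupling p q T "MaxOT x y \<sigma>"
  proof (rule diagonal_transport_coupling.intro)
    show "prob_space (density lborel p)" "prob_space (density lborel q)"
      using prob_space_mvn_isotropic[OF \<sigma>] by (simp_all add: p_def q_def mvn_def)
    show "T w \<noteq> w" if "q w < p w" for w
      using t_gt[of w] eT[of w] that unfolding less_iff by auto
    show "0 \<le> p w" "0 \<le> q w" for w
      using f_pos g_pos \<psi>_pos[of w] by (simp_all add: p_eq q_eq less_imp_le)
    show "sets (MaxOT x y \<sigma>) = sets borel" by (simp add: MaxOT_def Let_def)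
  qed (measurable, (fact push int)+)
  \<comment> \<open>Testing \<open>J\<close> with the constant 1 reduces the claim to the line,
    where \<open>f\<close> exceeds \<open>g\<close> on an interval ending at the midpoint.\<close>
  have excess: "(\<integral>\<^sup>+w. ennreal (p w - q w) \<partial>lborel) \<noteq> 0"
  proof
    assume "(\<integral>\<^sup>+w. ennreal (p w - q w) \<partial>lborel) = 0"
    moreover have "J (\<lambda>_. 1) s = 1" for s
      by (simp add: J_def nn_integral_mvn_density[OF \<sigma>])
    ultimately have "(\<integral>\<^sup>+s. ennreal (f s - g s) \<partial>lborel) = 0"
      using J[of "\<lambda>s. ennreal (f s - g s)" "\<lambda>_. 1"] by (simp add: diff_eq)
    then have "AE s in lborel. s \<in> UNIV \<longrightarrow> f s - g s \<le> 0"
      by (subst (asm) nn_integral_0_iff_AE) (auto simp: ennreal_eq_0_iff)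
    moreover have "\<not> (AE s in lborel. s \<in> UNIV \<longrightarrow> f s - g s \<le> 0)"
      by (rule pos_on_interval_not_AE_zero[of "(u + v) / 2 - 1" "(u + v) / 2"])
        (linarith, simp add: f_def g_def normal_density_less_iff[OF \<sigma> uv])
    ultimately show False by contradiction
  qed
  have "is_ot_coupling (residual_fst (MaxOT x y \<sigma>)) (residual_snd (MaxOT x y \<sigma>)) (off_diagonal_law (MaxOT x y \<sigma>))"
  \<comment> \<open>The support is the graph of \<open>T\<close> over the half-space where
    \<open>q < p\<close>. The hyperplane through the midpoint separates it from its image, and
    monotonicity along \<open>e\<close> is that of \<open>t\<close>.\<close>
  proof (rule monotone_coupling_is_ot[OF coupling_residuals[OF excess] e AE_off_diagonal_law, where c = "(u + v) / 2"])
    fix r assume "r \<in> {(w, T w) | w. q w < p w}"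
    then obtain w where w: "r = (w, T w)" "e \<bullet> w < (u + v) / 2" by (auto simp: less_iff)
    have "snd r - fst r = (t (e \<bullet> w) - e \<bullet> w) *\<^sub>R e" unfolding w T_def by (simp add: algebra_simps)
    then show "\<exists>c. snd r - fst r = c *\<^sub>R e" ..
    show "e \<bullet> fst r \<le> (u + v) / 2 \<and> (u + v) / 2 \<le> e \<bullet> snd r"
      using w t_gt[of w] by (simp add: eT)
    fix r' assume "r' \<in> {(w, T w) | w. q w < p w}" and le: "e \<bullet> fst r < e \<bullet> fst r'"
    then obtain w' where w': "r' = (w', T w')" "e \<bullet> w' < (u + v) / 2" by (auto simp: less_iff)
    show "e \<bullet> snd r \<le> e \<bullet> snd r'"
      using le w w' transport_map_mono[OF \<sigma> uv, of "e \<bullet> w" "e \<bullet> w'"] by (simp add: eT t_def)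
  qed
  then show ?thesis
    using maximal_coupling by (simp add: is_maximal_ot_coupling_def mvn_def p_def q_def)
qed

end
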